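(* Let $X$ be a locally convex Hausdorff real topological vector space and let $(f_i)_{i\in I}\subset\Gamma(X)$ be such that the system $(\mathrm S)$: $\{f_i(x)\le 0,\ i\in I\}$ is inconsistent (has no solution $x\in X$). Let $f_0:=\sup_{i\in I}f_i$. Assume that $f_0$ is proper and weakly inf-locally compact, and that $\overline{\operatorname{cone}}\,\operatorname{co}\bigcup_{i\in I}\operatorname{dom}f_i^*$ is a linear subspace of $X^*$. Then the set $\ell_\infty\text{-}\operatorname{sol}(\mathrm S)$ of minimizers of $f_0$ over $X$ is the sum of a nonempty convex weakly compact set and a finite-dimensional linear subspace of $X$. Moreover, one has $$\inf_{x\in X}\sup_{i\in I}f_i(x)=\max\Big\{\inf_{x\in X}\sum_{i\in I}\lambda_i f_i(x):\lambda\in S_I\Big\}$$ (equality of values with the maximum attained) if and only if $$\bigcup_{\lambda\in S_I}\operatorname{epi}\Big(\sum_{i\in I}\lambda_i f_i\Big)^*\ \text{ is } w^*\text{-closed regarding }\{0_{X^*}\}\times\mathbb R.$$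
   Context: $X^*$ is the topological dual of $X$, equipped with the weak$^*$ topology ($X^*\times\mathbb R$ with the product topology). $I$ is an infinite index set. $\Gamma(X)$ is the set of proper lower semicontinuous convex functions $X\to\mathbb R\cup\{+\infty\}$. For $h:X\to\overline{\mathbb R}$, $h^*(x^* )=\sup_{x\in X}\{\langle x^*,x\rangle-h(x)\}$; $\operatorname{dom}$ denotes the set where a function is $<+\infty$; $\operatorname{epi}h^*=\{(x^*,r)\in X^*\times\mathbb R:h^*(x^* )\le r\}$. A function is weakly inf-locally compact if each of its lower level sets $\{x:f_0(x)\le r\}$, $r\in\mathbb R$, is weakly locally compact. $\operatorname{co}A$ is the convex hull; $\operatorname{cone}A$ is the cone generated by $A\cup\{0\}$, i.e. $\{ta:t\ge0,\ a\in A\}$ for $A\ne\emptyset$, and $\overline{\operatorname{cone}}A$ its weak$^*$ closure. $S_I=\{\lambda\in\mathbb R^{(I)}:\sum_{i\in I}\lambda_i=1,\ \lambda_i\ge0\ \forall i\in I\}$, where $\mathbb R^{(I)}$ is the space of functions $\lambda:I\to\mathbb R$ with finite support $\operatorname{supp}\lambda=\{i:\lambda_i\ne0\}$. For $\lambda\in S_I$, $\sum_{i\in I}\lambda_i f_i$ stands for $\sum_{i\in\operatorname{supp}\lambda}\lambda_i f_i$. A set $C$ is ($w^*$-)closed regarding a set $B$ if $B\cap\overline{C}=B\cap C$. *)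

theory Defs
  imports "HOL-Analysis.Analysis"
begin

text \<open>In the last axiom the library predicate \<^const>\<open>convex\<close> is written out, because it is
  not available inside a class specification; the lemma below states the axiom with it.\<close>

class hausdorff_lcs = real_vector + topological_ab_group_add + t2_space +
  assumes tendsto_scaleR_Pair: "LIM x (nhds t \<times>\<^sub>F nhds a). fst x *\<^sub>R snd x :> nhds (t *\<^sub>R a)"
    and locally_convex_raw: "open U \<Longrightarrow> 0 \<in> U \<Longrightarrow>
      \<exists>V. open V \<and> (\<forall>a\<in>V. \<forall>b\<in>V. \<forall>u\<ge>0. \<forall>v\<ge>0. u + v = 1 \<longrightarrow> u *\<^sub>R a + v *\<^sub>R b \<in> V) \<and> 0 \<in> V \<and> V \<subseteq> U"

lemma locally_convex:
  fixes U :: "'a::hausdorff_lcs set"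
  assumes "open U" "0 \<in> U"
  shows "\<exists>V. open V \<and> convex V \<and> 0 \<in> V \<and> V \<subseteq> U"
  using locally_convex_raw[OF assms] unfolding convex_def by blast

typedef (overloaded) 'a continuous_dual =
    "{\<phi> :: 'a::hausdorff_lcs \<Rightarrow> real. linear \<phi> \<and> continuous_on UNIV \<phi>}"
  morphisms dual_apply Abs_dual
proof
  show "(\<lambda>x. 0) \<in> {\<phi> :: 'a \<Rightarrow> real. linear \<phi> \<and> continuous_on UNIV \<phi>}"
    by (auto simp: linear_iff)
qed

setup_lifting type_definition_continuous_dual

instantiation continuous_dual :: (hausdorff_lcs) real_vector
begin

lift_definition zero_continuous_dual :: "'a continuous_dual" is "\<lambda>x. 0"
  by (auto simp: linear_iff)

lift_definition plus_continuous_dual ::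
    "'a continuous_dual \<Rightarrow> 'a continuous_dual \<Rightarrow> 'a continuous_dual"
  is "\<lambda>\<phi> \<psi> x. \<phi> x + \<psi> x"
  by (auto simp: linear_iff algebra_simps intro!: continuous_intros)

lift_definition uminus_continuous_dual :: "'a continuous_dual \<Rightarrow> 'a continuous_dual"
  is "\<lambda>\<phi> x. - \<phi> x"
  by (auto simp: linear_iff intro!: continuous_intros)

lift_definition minus_continuous_dual ::
    "'a continuous_dual \<Rightarrow> 'a continuous_dual \<Rightarrow> 'a continuous_dual"
  is "\<lambda>\<phi> \<psi> x. \<phi> x - \<psi> x"
  by (auto simp: linear_iff algebra_simps intro!: continuous_intros)

lift_definition scaleR_continuous_dual ::
    "real \<Rightarrow> 'a continuous_dual \<Rightarrow> 'a continuous_dual"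
  is "\<lambda>t \<phi> x. t * \<phi> x"
  by (auto simp: linear_iff algebra_simps intro!: continuous_intros)

instance
  by standard (transfer; force simp: algebra_simps)+

end

text \<open>The dual always carries the weak-star topology, that is, the topology of pointwise
  convergence: the initial topology for the inclusion into the space of all real functions, whose
  library topology is the product topology.\<close>

instantiation continuous_dual :: (hausdorff_lcs) topological_space
begin

definition open_continuous_dual :: "'a continuous_dual set \<Rightarrow> bool"
  where "open U \<longleftrightarrow> openin (pullback_topology UNIV dual_apply euclidean) U"

instance
proof
  show "open (UNIV :: 'a continuous_dual set)"
    unfolding open_continuous_dual_def
    by (metis Int_UNIV_left openin_topspace topspace_euclidean topspace_pullback_topology
        vimage_UNIV)
qed (auto simp: open_continuous_dual_def)

end

text \<open>The weak topology is the initial topology for the map sending a point to its family of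
  values under all continuous linear functionals.\<close>

definition weak_topology :: "'a::hausdorff_lcs topology"
  where "weak_topology = pullback_topology UNIV (\<lambda>x \<phi>. dual_apply \<phi> x) euclidean"

definition edom :: "('a \<Rightarrow> ereal) \<Rightarrow> 'a set"
  where "edom h = {x. h x < \<infinity>}"

definition epi :: "('a \<Rightarrow> ereal) \<Rightarrow> ('a \<times> real) set"
  where "epi h = {(x, r). h x \<le> ereal r}"

definition proper_fun :: "('a \<Rightarrow> ereal) \<Rightarrow> bool"
  where "proper_fun h \<longleftrightarrow> (\<forall>x. h x \<noteq> -\<infinity>) \<and> edom h \<noteq> {}"

definition lsc_fun :: "('a::topological_space \<Rightarrow> ereal) \<Rightarrow> bool"
  where "lsc_fun h \<longleftrightarrow> (\<forall>r::real. closed {x. h x \<le> ereal r})"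

text \<open>Only used for functions without the value \<open>-\<infinity>\<close>. The parameter is kept in
  the open unit interval, so that \<open>0 * \<infinity> = 0\<close> plays no role.\<close>

definition convex_fun :: "('a::real_vector \<Rightarrow> ereal) \<Rightarrow> bool"
  where "convex_fun h \<longleftrightarrow>
    (\<forall>x y. \<forall>t::real. 0 < t \<longrightarrow> t < 1 \<longrightarrow>
      h ((1 - t) *\<^sub>R x + t *\<^sub>R y) \<le> ereal (1 - t) * h x + ereal t * h y)"

definition Gamma_fun :: "('a::hausdorff_lcs \<Rightarrow> ereal) set"
  where "Gamma_fun = {h. proper_fun h \<and> lsc_fun h \<and> convex_fun h}"

definition fenchel_conj :: "('a::hausdorff_lcs \<Rightarrow> ereal) \<Rightarrow> 'a continuous_dual \<Rightarrow> ereal"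
  where "fenchel_conj h \<phi> = (SUP x. ereal (dual_apply \<phi> x) - h x)"

definition weakly_inf_locally_compact :: "('a::hausdorff_lcs \<Rightarrow> ereal) \<Rightarrow> bool"
  where "weakly_inf_locally_compact h \<longleftrightarrow>
    (\<forall>r::real. locally_compact_space (subtopology weak_topology {x. h x \<le> ereal r}))"

text \<open>The library's \<open>cone hull {}\<close> is empty; adjoining \<open>0\<close> gives the usual convention.\<close>

definition cone_gen :: "'a::real_vector set \<Rightarrow> 'a set"
  where "cone_gen A = cone hull (insert 0 A)"

definition supp :: "('i \<Rightarrow> real) \<Rightarrow> 'i set"
  where "supp l = {i. l i \<noteq> 0}"

text \<open>A weight vector indexed by \<open>I\<close> is represented by a function on the whole type
  vanishing outside \<open>I\<close>.\<close>

definition unit_simplex :: "'i set \<Rightarrow> ('i \<Rightarrow> real) set"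
  where "unit_simplex I =
    {l. finite (supp l) \<and> supp l \<subseteq> I \<and> (\<Sum>i\<in>supp l. l i) = 1 \<and> (\<forall>i\<in>I. 0 \<le> l i)}"

definition weighted_sum :: "('i \<Rightarrow> real) \<Rightarrow> ('i \<Rightarrow> 'a \<Rightarrow> ereal) \<Rightarrow> 'a \<Rightarrow> ereal"
  where "weighted_sum l f x = (\<Sum>i\<in>supp l. ereal (l i) * f i x)"

definition sup_fun :: "'i set \<Rightarrow> ('i \<Rightarrow> 'a \<Rightarrow> ereal) \<Rightarrow> 'a \<Rightarrow> ereal"
  where "sup_fun I f x = (SUP i\<in>I. f i x)"

definition minimizers :: "('a \<Rightarrow> ereal) \<Rightarrow> 'a set"
  where "minimizers h = {x. \<forall>y. h x \<le> h y}"

definition is_max_of :: "ereal \<Rightarrow> ereal set \<Rightarrow> bool"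
  where "is_max_of m A \<longleftrightarrow> m \<in> A \<and> (\<forall>a\<in>A. a \<le> m)"

definition closed_regarding :: "'a::topological_space set \<Rightarrow> 'a set \<Rightarrow> bool"
  where "closed_regarding C B \<longleftrightarrow> B \<inter> closure C = B \<inter> C"

end

theory Submission
  imports Defs
begin

text \<open>
  The dual is recovered from Hahn--Banach in the form of a separation by sublinear functionals, and
  every member of \<open>\<Gamma>(X)\<close> is the supremum of its continuous affine minorants. So the sublevel
  sets of \<open>f\<^sub>0\<close> are intersections of weakly closed half-spaces whose normals lie in \<open>\<Union> dom f\<^sub>i\<^sup>*\<close>.

  Every recession direction \<open>d\<close> of a sublevel set satisfies \<open>\<phi> d \<le> 0\<close> for all these normals, hence on
  the closed cone they generate; as that is a subspace, \<open>d\<close> lies in its annihilator \<open>L\<close>, along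
  which \<open>f\<^sub>0\<close> is constant. Local compactness makes \<open>L\<close> finite-dimensional, so that there is a
  continuous projection \<open>P\<close> onto \<open>L\<close>. The slice of a sublevel set by \<open>ker P\<close> is locally
  compact and contains no ray, hence is weakly compact, and \<open>f\<^sub>0\<close> attains its infimum \<open>m\<close> there.

  Let \<open>A\<close> be the union of the epigraphs in the statement. The maximum is attained
    and equal to \<open>m\<close> iff
  \<open>(0, -m)\<close> lies in \<open>A\<close>. The closure of \<open>A\<close> meets \<open>{0} \<times> \<real>\<close> only in points \<open>(0, r)\<close> with
  \<open>r \<ge> -m\<close>, and it contains \<open>(0, -m)\<close>: otherwise a weak-star continuous functional separating
  \<open>(0, -m)\<close> from \<open>A\<close> would give a point where \<open>f\<^sub>0\<close> is smaller than \<open>m\<close>.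
\<close>

subsection \<open>Sublinear functionals and the Hahn--Banach theorem\<close>

text \<open>Homogeneity is demanded only as an inequality for positive factors, which is easy to
  check for infima; applied to \<open>c\<close> and to \<open>1/c\<close> it gives equality.\<close>

definition sublin :: "('a::real_vector \<Rightarrow> real) \<Rightarrow> bool"
  where "sublin p \<longleftrightarrow>
    (\<forall>x y. p (x + y) \<le> p x + p y) \<and> (\<forall>c x. 0 < c \<longrightarrow> p (c *\<^sub>R x) \<le> c * p x)"

lemma sublinI:
  assumes "\<And>x y. p (x + y) \<le> p x + p y" "\<And>c x. 0 < c \<Longrightarrow> p (c *\<^sub>R x) \<le> c * p x"
  shows "sublin p"
  using assms unfolding sublin_def by blast

lemma sublin_add: "sublin p \<Longrightarrow> p (x + y) \<le> p x + p y"
  unfolding sublin_def by blast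

lemma sublin_scale_le: "sublin p \<Longrightarrow> 0 < c \<Longrightarrow> p (c *\<^sub>R x) \<le> c * p x"
  unfolding sublin_def by blast

lemma sublin_zero:
  assumes "sublin p"
  shows "p 0 = 0"
  using sublin_scale_le[OF assms, of 2 0] sublin_scale_le[OF assms, of "1/2" 0] by simp

lemma sublin_scale:
  assumes "sublin p" "0 \<le> c"
  shows "p (c *\<^sub>R x) = c * p x"
proof (cases "c = 0")
  case True
  then show ?thesis using sublin_zero[OF assms(1)] by simp
next
  case False
  with assms have c: "0 < c" by simp
  have "p ((1/c) *\<^sub>R (c *\<^sub>R x)) \<le> (1/c) * p (c *\<^sub>R x)"
    by (rule sublin_scale_le) (use assms c in auto)
  then have "c * p x \<le> p (c *\<^sub>R x)" using c by (simp add: field_simps)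
  with sublin_scale_le[OF assms(1) c, of x] show ?thesis by simp
qed

lemma sublin_minus:
  assumes "sublin p"
  shows "- p (- x) \<le> p x"
  using sublin_add[OF assms, of x "- x"] sublin_zero[OF assms] by simp

text \<open>\<open>q\<close> is the infimum of \<open>p (v + g) - d\<close> over the cone
  \<open>G\<close>; subadditivity and \<open>d \<le> p g\<close> bound it below by
  \<open>- p (- v)\<close>. A linear \<open>l \<le> q\<close> then satisfies
  \<open>d \<le> l g\<close> for every \<open>(g, d)\<close> in \<open>G\<close>, since
  \<open>l (- g) \<le> q (- g) \<le> p 0 - d\<close>.\<close>

lemma sublin_tilt:
  fixes p :: "'a::real_vector \<Rightarrow> real"
  assumes p: "sublin p"
    and G0: "(0, 0) \<in> G"
    and Gadd: "\<And>g d h e. (g, d) \<in> G \<Longrightarrow> (h, e) \<in> G \<Longrightarrow> (g + h, d + e) \<in> G"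
    and Gsc: "\<And>c g d. 0 < c \<Longrightarrow> (g, d) \<in> G \<Longrightarrow> (c *\<^sub>R g, c * d) \<in> G"
    and le: "\<And>g d. (g, d) \<in> G \<Longrightarrow> d \<le> p g"
  obtains q where "sublin q" "\<And>v g d. (g, d) \<in> G \<Longrightarrow> q v \<le> p (v + g) - d"
proof
  define q where "q v = (INF (g, d) \<in> G. p (v + g) - d)" for v
  have bdd: "bdd_below ((\<lambda>(g, d). p (v + g) - d) ` G)" for v
  proof (rule bdd_belowI[of _ "- p (- v)"])
    fix z assume "z \<in> (\<lambda>(g, d). p (v + g) - d) ` G"
    then obtain g d where gd: "(g, d) \<in> G" "z = p (v + g) - d" by auto
    have "p g \<le> p (- v) + p (v + g)" using sublin_add[OF p, of "- v" "v + g"] by simp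
    then show "- p (- v) \<le> z" using le[OF gd(1)] gd(2) by simp
  qed
  have ne: "(\<lambda>(g, d). p (v + g) - d) ` G \<noteq> {}" for v using G0 by auto
  show qle: "q v \<le> p (v + g) - d" if "(g, d) \<in> G" for v g d
    using cINF_lower[OF bdd[of v] that] unfolding q_def by simp
  have qge: "z \<le> q v" if "\<And>g d. (g, d) \<in> G \<Longrightarrow> z \<le> p (v + g) - d" for z v
    unfolding q_def by (rule cINF_greatest) (use G0 that in auto)
  show "sublin q"
  proof (rule sublinI)
    fix v w
    have "q (v + w) - (p (w + h) - e) \<le> q v" if h: "(h, e) \<in> G" for h e
    proof (rule qge)
      fix g d assume g: "(g, d) \<in> G"
      have "p (v + w + (g + h)) \<le> p (v + g) + p (w + h)"
        using sublin_add[OF p, of "v + g" "w + h"] by (simp add: algebra_simps)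
      with qle[OF Gadd[OF g h], of "v + w"]
      show "q (v + w) - (p (w + h) - e) \<le> p (v + g) - d" by simp
    qed
    then have "q (v + w) - q v \<le> q w" by (intro qge) (force simp: algebra_simps)
    then show "q (v + w) \<le> q v + q w" by simp
  next
    fix c v assume c: "(0::real) < c"
    have "q (c *\<^sub>R v) / c \<le> q v"
    proof (rule qge)
      fix g d assume g: "(g, d) \<in> G"
      have "q (c *\<^sub>R v) \<le> p (c *\<^sub>R v + c *\<^sub>R g) - c * d" by (rule qle[OF Gsc[OF c g]])
      also have "\<dots> \<le> c * (p (v + g) - d)"
        using sublin_scale_le[OF p c, of "v + g"] by (simp add: algebra_simps)
      finally show "q (c *\<^sub>R v) / c \<le> p (v + g) - d" using c by (simp add: field_simps)
    qed
    then show "q (c *\<^sub>R v) \<le> c * q v" using c by (simp add: field_simps)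
  qed
qed

text \<open>Minimal sublinear functionals are linear, so Zorn's lemma is applied to the sublinear
  functionals below \<open>p\<close> with the order reversed in \<open>R\<close>.\<close>

lemma hahn_banach_sublin:
  fixes p :: "'a::real_vector \<Rightarrow> real"
  assumes p: "sublin p"
  obtains l where "linear l" "\<And>x. l x \<le> p x"
proof -
  define A where "A = {q. sublin q \<and> (\<forall>x. q x \<le> p x)}"
  define R where "R = (\<lambda>(q :: 'a \<Rightarrow> real) r. r \<le> q)"
  have "\<exists>m\<in>A. \<forall>a\<in>A. R m a \<longrightarrow> a = m"
  proof (rule predicate_Zorn)
    show "partial_order_on A (relation_of R A)"
      by (rule partial_order_on_relation_ofI) (auto simp: R_def)
    fix C assume "C \<in> Chains (relation_of R A)"
    then have C: "C \<subseteq> A" and chain: "\<And>q r. q \<in> C \<Longrightarrow> r \<in> C \<Longrightarrow> q \<le> r \<or> r \<le> q"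
      by (auto simp: Chains_def relation_of_def R_def)
    show "\<exists>u\<in>A. \<forall>a\<in>C. R a u"
    proof (cases "C = {}")
      case True
      then show ?thesis using p by (auto simp: A_def)
    next
      case False
      define u where "u x = (INF q\<in>C. q x)" for x
      have sub: "sublin q" and qp: "q x \<le> p x" if "q \<in> C" for q x
        using that C by (auto simp: A_def)
      have bdd: "bdd_below ((\<lambda>q. q x) ` C)" for x
      proof (rule bdd_belowI2[of _ "- p (- x)"])
        fix q assume q: "q \<in> C"
        show "- p (- x) \<le> q x" using sublin_minus[OF sub[OF q], of x] qp[OF q, of "- x"] by simp
      qed
      have ule: "u x \<le> q x" if "q \<in> C" for q x
        unfolding u_def by (rule cINF_lower[OF bdd that])
      have uge: "z \<le> u x" if "\<And>q. q \<in> C \<Longrightarrow> z \<le> q x" for z x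
        unfolding u_def by (rule cINF_greatest[OF False that])
      have "sublin u"
      proof (rule sublinI)
        fix x y
        have "u (x + y) - r y \<le> u x" if r: "r \<in> C" for r
        proof (rule uge)
          fix q assume q: "q \<in> C"
          \<comment> \<open>A single member of the chain below both \<open>q\<close> and
            \<open>r\<close> makes the infimum subadditive.\<close>
          obtain s where s: "s \<in> C" "s \<le> q" "s \<le> r" using chain[OF q r] q r by blast
          have "u (x + y) \<le> s x + s y" using ule[OF s(1), of
            "x + y"] sublin_add[OF sub[OF s(1)], of x y] by simp
          with le_funD[OF s(2), of x] le_funD[OF s(3), of y] show "u (x + y) - r y \<le> q x" by simp
        qed
        then have "u (x + y) - u x \<le> u y" by (intro uge) (force simp: algebra_simps)
        then show "u (x + y) \<le> u x + u y" by simp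
      next
        fix c x assume c: "(0::real) < c"
        have "u (c *\<^sub>R x) / c \<le> u x"
        proof (rule uge)
          fix q assume q: "q \<in> C"
          have "u (c *\<^sub>R x) \<le> c * q x"
            using ule[OF q, of "c *\<^sub>R x"] sublin_scale_le[OF sub[OF q] c, of x] by simp
          then show "u (c *\<^sub>R x) / c \<le> q x" using c by (simp add: field_simps)
        qed
        then show "u (c *\<^sub>R x) \<le> c * u x" using c by (simp add: field_simps)
      qed
      moreover have "u x \<le> p x" for x
        using False ule qp order_trans by (metis all_not_in_conv)
      ultimately have "u \<in> A" by (simp add: A_def)
      then show ?thesis using ule by (auto simp: R_def le_fun_def)
    qed
  qed
  then obtain l where lA: "l \<in> A" and min: "\<And>q. q \<in> A \<Longrightarrow> q \<le> l \<Longrightarrow> q = l"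
    by (auto simp: R_def)
  have l: "sublin l" and lp: "l x \<le> p x" for x using lA by (auto simp: A_def)
  \<comment> \<open>Tilting a minimal element along \<open>v\<close> cannot decrease it, which forces it to be odd.\<close>
  have neg: "l (- v) = - l v" for v
  proof -
    obtain q where q: "sublin q"
      "\<And>w g d. (g, d) \<in> {(t *\<^sub>R v, t * l v) | t. 0 \<le> t} \<Longrightarrow> q w \<le> l (w + g) - d"
    proof (rule sublin_tilt[OF l, of "{(t *\<^sub>R v, t * l v) | t. 0 \<le> t}"], goal_cases)
      case 1 show ?case by force
    next
      case (2 g d h e)
      then obtain s t where "0 \<le> s" "0 \<le> t" "g = s *\<^sub>R v" "d = s * l v" "h = t *\<^sub>R v" "e = t * l v"
        by auto
      then show ?case by (auto intro!: exI[of _ "s + t"] simp: algebra_simps)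
    next
      case (3 c g d)
      then obtain t where "0 \<le> t" "g = t *\<^sub>R v" "d = t * l v" by auto
      with 3 show ?case by (auto intro!: exI[of _ "c * t"])
    next
      case (4 g d) then show ?case by (auto simp: sublin_scale[OF l])
    next
      case 5 then show ?case using that by blast
    qed
    have qv: "q w \<le> l (w + t *\<^sub>R v) - t * l v" if "0 \<le> t" for w t using q(2) that by blast
    have "q \<le> l" using qv[of 0] by (simp add: le_fun_def)
    then have "q = l" using q(1) lp by (intro min) (auto simp: A_def le_fun_def intro: order_trans)
    then have "l (- v) \<le> - l v" using qv[of 1 "- v"] sublin_zero[OF l] by simp
    with sublin_minus[OF l, of "v"] show ?thesis by simp
  qed
  have "linear l"
  proof (rule linearI)
    fix x y show "l (x + y) = l x + l y"
      using sublin_add[OF l, of x y] sublin_add[OF l, of "- x" "- y"] neg[of x] neg[of y] neg[of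
        "x + y"]
      by simp
  next
    fix c x show "l (c *\<^sub>R x) = c *\<^sub>R l x"
    proof (cases "0 \<le> c")
      case True then show ?thesis by (simp add: sublin_scale[OF l])
    next
      case False
      then have "l ((- c) *\<^sub>R x) = - c * l x" by (intro sublin_scale[OF l]) simp
      then show ?thesis using neg[of "c *\<^sub>R x"] by simp
    qed
  qed
  then show thesis using that lp by blast
qed

text \<open>Tilt \<open>p\<close> along the cone over the product of \<open>A\<close> and
  \<open>{e}\<close>, which is closed under addition because \<open>A\<close> is convex. For
  \<open>e > 0\<close> the hypothesis says that \<open>A\<close> misses the set
  \<open>p < e\<close>, a neighbourhood of 0 in both applications.\<close>

lemma sublin_separation:
  fixes p :: "'a::real_vector \<Rightarrow> real"
  assumes p: "sublin p" and A: "convex A" "A \<noteq> {}" and e: "\<And>a. a \<in> A \<Longrightarrow> e \<le> p a"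
  obtains l where "linear l" "\<And>x. l x \<le> p x" "\<And>a. a \<in> A \<Longrightarrow> e \<le> l a"
proof -
  define G where "G = {(t *\<^sub>R a, t * e) | t a. 0 \<le> t \<and> a \<in> A}"
  have G0: "(0, 0) \<in> G" using A(2) by (force simp: G_def)
  obtain q where q: "sublin q" "\<And>w g d. (g, d) \<in> G \<Longrightarrow> q w \<le> p (w + g) - d"
  proof (rule sublin_tilt[OF p, of G], goal_cases)
    case 1 show ?case by (rule G0)
  next
    case (2 g d h d')
    then obtain s t a b where st: "0 \<le> s" "0 \<le> t" "g = s *\<^sub>R a" "d = s * e" "h = t *\<^sub>R b"
      "d' = t * e"
      "a \<in> A" "b \<in> A" by (auto simp: G_def)
    show ?case
    proof (cases "s + t = 0")
      case True
      then have "s = 0" "t = 0" using st by auto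
      then show ?thesis using st G0 by simp
    next
      case False
      then have pos: "0 < s + t" using st by simp
      define c where "c = (s / (s + t)) *\<^sub>R a + (t / (s + t)) *\<^sub>R b"
      have "c \<in> A" unfolding c_def using A(1) st pos
        by (intro convexD) (auto simp: add_divide_distrib[symmetric])
      moreover have "g + h = (s + t) *\<^sub>R c" using st pos by (simp add: c_def scaleR_add_right)
      ultimately show ?thesis using pos st
        by (auto simp: G_def algebra_simps intro!: exI[of _ "s + t"] exI[of _ c])
    qed
  next
    case (3 c g d)
    then obtain t a where "0 \<le> t" "g = t *\<^sub>R a" "d = t * e" "a \<in> A" by (auto simp: G_def)
    with 3 show ?case by (auto simp: G_def intro!: exI[of _ "c * t"] exI[of _ a])
  next
    case (4 g d) then show ?case using e by (auto simp: G_def sublin_scale[OF p] mult_left_mono)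
  next
    case 5 then show ?case using that by blast
  qed
  obtain l where l: "linear l" "\<And>x. l x \<le> q x" using hahn_banach_sublin[OF q(1)] by blast
  show thesis
  proof
    from q(2)[OF G0] show "l x \<le> p x" for x using l(2)[of x] by (smt (verit) add.right_neutral)
    fix a assume "a \<in> A"
    then have "(a, e) \<in> G" by (force simp: G_def intro!: exI[of _ 1])
    from q(2)[OF this, of "- a"] l(2)[of "- a"] sublin_zero[OF p] linear_neg[OF l(1), of a]
    show "e \<le> l a" by simp
  qed (rule l(1))
qed

subsection \<open>Gauges and continuous functionals\<close>

lemma hausdorff_lcs_tendsto_scaleR:
  fixes v :: "'a::hausdorff_lcs"
  assumes "(g \<longlongrightarrow> t) F" "(h \<longlongrightarrow> v) F"
  shows "((\<lambda>z. g z *\<^sub>R h z) \<longlongrightarrow> t *\<^sub>R v) F"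
proof -
  have "filterlim (\<lambda>z. (g z, h z)) (nhds t \<times>\<^sub>F nhds v) F"
    using assms by (intro filterlim_Pair)
  from filterlim_compose[OF tendsto_scaleR_Pair this] show ?thesis by simp
qed

lemma open_absorbing:
  fixes V :: "'a::hausdorff_lcs set"
  assumes "open V" "0 \<in> V"
  obtains t where "0 < t" "v /\<^sub>R t \<in> V"
proof -
  have "((\<lambda>n. inverse (real (Suc n)) *\<^sub>R v) \<longlongrightarrow> 0 *\<^sub>R v) sequentially"
    by (intro hausdorff_lcs_tendsto_scaleR LIMSEQ_inverse_real_of_nat tendsto_const)
  then have "\<forall>\<^sub>F n in sequentially. inverse (real (Suc n)) *\<^sub>R v \<in> V"
    using assms by (auto simp: tendsto_def)
  then obtain n where "inverse (real (Suc n)) *\<^sub>R v \<in> V" by (auto simp: eventually_sequentially)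
  then show thesis by (intro that[of "real (Suc n)"]) auto
qed

text \<open>The Minkowski functional of \<open>V\<close>; without symmetry of \<open>V\<close> it is
  only sublinear. Subadditivity holds because \<open>(v + w) / (t + s)\<close> is a convex
  combination of \<open>v / t\<close> and \<open>w / s\<close>.\<close>

lemma gauge_sublin:
  fixes V :: "'a::hausdorff_lcs set"
  assumes V: "open V" "convex V" "0 \<in> V"
  obtains p where "sublin p" "\<And>v. 0 \<le> p v" "\<And>v. v \<in> V \<Longrightarrow> p v \<le> 1" "\<And>v. p v < 1 \<Longrightarrow> v \<in> V"
proof
  define T where "T v = {t. 0 < t \<and> v /\<^sub>R t \<in> V}" for v
  define p where "p v = Inf (T v)" for v
  have ne: "T v \<noteq> {}" for v using open_absorbing[OF V(1,3), of v] unfolding T_def by blast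
  have bdd: "bdd_below (T v)" for v by (rule bdd_belowI[of _ 0]) (auto simp: T_def)
  have ple: "p v \<le> t" if "t \<in> T v" for t v unfolding p_def by (rule cInf_lower[OF that bdd])
  have pge: "z \<le> p v" if "\<And>t. t \<in> T v \<Longrightarrow> z \<le> t" for z v
    unfolding p_def by (rule cInf_greatest[OF ne that])
  show "0 \<le> p v" for v by (rule pge) (auto simp: T_def)
  show "p v \<le> 1" if "v \<in> V" for v using that by (intro ple) (auto simp: T_def)
  show "v \<in> V" if lt: "p v < 1" for v
  proof -
    obtain t where t: "t \<in> T v" "t < 1" using cInf_lessD[OF ne lt[unfolded p_def]] by blast
    then have "t *\<^sub>R (v /\<^sub>R t) + (1 - t) *\<^sub>R 0 \<in> V"
      using V by (intro convexD) (auto simp: T_def)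
    then show ?thesis using t by (simp add: T_def)
  qed
  show "sublin p"
  proof (rule sublinI)
    fix v w
    have "p (v + w) - s \<le> p v" if s: "s \<in> T w" for s
    proof (rule pge)
      fix t assume t: "t \<in> T v"
      have "(t / (t + s)) *\<^sub>R (v /\<^sub>R t) + (s / (t + s)) *\<^sub>R (w /\<^sub>R s) \<in> V"
        using V t s by (intro convexD) (auto simp: T_def add_divide_distrib[symmetric])
      moreover have "(t / (t + s)) *\<^sub>R (v /\<^sub>R t) + (s / (t + s)) *\<^sub>R (w /\<^sub>R s) = (v + w) /\<^sub>R (t + s)"
        using t s by (simp add: T_def scaleR_add_right inverse_eq_divide)
      ultimately have "t + s \<in> T (v + w)" using t s by (simp add: T_def)
      from ple[OF this] show "p (v + w) - s \<le> t" by simp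
    qed
    then have "p (v + w) - p v \<le> p w" by (intro pge) (force simp: algebra_simps)
    then show "p (v + w) \<le> p v + p w" by simp
  next
    fix c v assume c: "(0::real) < c"
    have "p (c *\<^sub>R v) / c \<le> p v"
    proof (rule pge)
      fix t assume "t \<in> T v"
      moreover have "inverse (c * t) * c = inverse t" using c by (simp add: field_simps)
      then have "(c *\<^sub>R v) /\<^sub>R (c * t) = v /\<^sub>R t" by (simp only: scaleR_scaleR)
      ultimately have "c * t \<in> T (c *\<^sub>R v)" using c by (simp only: T_def mem_Collect_eq) simp
      from ple[OF this] show "p (c *\<^sub>R v) / c \<le> t" using c by (simp add: field_simps)
    qed
    then show "p (c *\<^sub>R v) \<le> c * p v" using c by (simp add: field_simps)
  qed
qed

lemma linear_continuous_if_bounded_on_nhd: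
  fixes l :: "'a::hausdorff_lcs \<Rightarrow> real"
  assumes l: "linear l" and V: "open V" "0 \<in> V" and le: "\<And>v. v \<in> V \<Longrightarrow> l v \<le> 1"
  shows "continuous_on UNIV l"
proof -
  have "(l \<longlongrightarrow> l x) (at x)" for x
  proof (rule tendstoI)
    fix e :: real assume e: "0 < e"
    \<comment> \<open>\<open>V\<close> may be asymmetric, so \<open>y - x\<close> and
      \<open>x - y\<close> are both scaled into it. The factor \<open>2 / e\<close> bounds the
      difference of the values by \<open>e / 2\<close>, strictly below \<open>e\<close>.\<close>
    have "((\<lambda>y. (2 / e) *\<^sub>R (y - x)) \<longlongrightarrow> (2 / e) *\<^sub>R (x - x)) (at x)"
      "((\<lambda>y. (2 / e) *\<^sub>R (x - y)) \<longlongrightarrow> (2 / e) *\<^sub>R (x - x)) (at x)"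
      by (intro hausdorff_lcs_tendsto_scaleR tendsto_intros)+
    then have "\<forall>\<^sub>F y in at x. (2 / e) *\<^sub>R (y - x) \<in> V" "\<forall>\<^sub>F y in at x. (2 / e) *\<^sub>R (x - y) \<in> V"
      using V by (auto simp: tendsto_def)
    then show "\<forall>\<^sub>F y in at x. dist (l y) (l x) < e"
    proof eventually_elim
      case (elim y)
      have "(2 / e) * (l y - l x) \<le> 1" "(2 / e) * (l x - l y) \<le> 1"
        using le[OF elim(1)] le[OF elim(2)] by (simp_all add: linear_diff[OF l] linear_scale[OF l])
      then show ?case using e by (simp add: dist_real_def field_simps abs_if)
    qed
  qed
  then show ?thesis by (simp add: continuous_on_def)
qed

lemma dual_of_linear:
  fixes l :: "'a::hausdorff_lcs \<Rightarrow> real"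
  assumes "linear l" "continuous_on UNIV l"
  obtains \<phi> where "dual_apply \<phi> = l"
  using that[of "Abs_dual l"] assms by (simp add: Abs_dual_inverse)

lemma linear_dual_apply: "linear (dual_apply \<phi>)"
  using dual_apply[of \<phi>] by simp

lemmas dual_apply_simps =
  linear_add[OF linear_dual_apply] linear_diff[OF linear_dual_apply]
  linear_scale[OF linear_dual_apply] linear_0[OF linear_dual_apply]
  linear_neg[OF linear_dual_apply] plus_continuous_dual.rep_eq minus_continuous_dual.rep_eq
  scaleR_continuous_dual.rep_eq zero_continuous_dual.rep_eq uminus_continuous_dual.rep_eq

subsection \<open>Affine minorants\<close>

text \<open>From here on conjugates are handled through continuous affine minorants
  \<open>\<phi> - r\<close>, and their suprema need not be computed.\<close>

lemma epi_fenchel_conj_iff: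
  "(\<phi>, r) \<in> epi (fenchel_conj h) \<longleftrightarrow> (\<forall>y. ereal (dual_apply \<phi> y - r) \<le> h y)"
proof -
  have "ereal (dual_apply \<phi> y) - h y \<le> ereal r \<longleftrightarrow> ereal (dual_apply \<phi> y - r) \<le> h y" for y
    by (cases "h y") auto
  then show ?thesis by (simp add: epi_def fenchel_conj_def SUP_le_iff)
qed

lemma edom_fenchel_conj_iff:
  "\<phi> \<in> edom (fenchel_conj h) \<longleftrightarrow> (\<exists>r. (\<phi>, r) \<in> epi (fenchel_conj h))"
proof
  assume "\<phi> \<in> edom (fenchel_conj h)"
  then have "fenchel_conj h \<phi> < \<infinity>" by (simp add: edom_def)
  then obtain r where "fenchel_conj h \<phi> < ereal r" using less_ereal.simps ereal_dense2 by blast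
  then show "\<exists>r. (\<phi>, r) \<in> epi (fenchel_conj h)" by (auto simp: epi_def intro: less_imp_le)
next
  assume "\<exists>r. (\<phi>, r) \<in> epi (fenchel_conj h)"
  then obtain r where "fenchel_conj h \<phi> \<le> ereal r" by (auto simp: epi_def)
  then show "\<phi> \<in> edom (fenchel_conj h)" by (auto simp: edom_def intro: le_less_trans)
qed

lemma convex_fun_epi:
  assumes "convex_fun h"
  shows "convex (epi h)"
  unfolding convex_alt
proof (intro ballI allI impI)
  fix a b :: "'a \<times> real" and t :: real
  assume ab: "a \<in> epi h" "b \<in> epi h" and t: "0 \<le> t \<and> t \<le> 1"
  obtain x r y s where xy: "a = (x, r)" "b = (y, s)" "h x \<le> ereal r" "h y \<le> ereal s"
    using ab by (auto simp: epi_def)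
  consider "t = 0" | "t = 1" | "0 < t" "t < 1" using t by fastforce
  then show "(1 - t) *\<^sub>R a + t *\<^sub>R b \<in> epi h"
  proof cases
    case 3
    have "h ((1 - t) *\<^sub>R x + t *\<^sub>R y) \<le> ereal (1 - t) * h x + ereal t * h y"
      using assms 3 by (simp add: convex_fun_def)
    also have "\<dots> \<le> ereal (1 - t) * ereal r + ereal t * ereal s"
      using xy 3 by (intro add_mono ereal_mult_left_mono) auto
    finally show ?thesis by (simp add: xy epi_def)
  qed (use ab in auto)
qed

text \<open>Lower semicontinuity keeps \<open>h\<close> above some \<open>\<beta> > \<alpha>\<close>
  near \<open>x\<close>, so a neighbourhood of \<open>(x, \<alpha>)\<close> misses the convex set
  \<open>epi h\<close> and Hahn-Banach applies. The height coefficient \<open>c\<close> cannot be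
  negative because epigraphs are upward closed.\<close>

lemma Gamma_fun_separation:
  fixes h :: "'a::hausdorff_lcs \<Rightarrow> ereal"
  assumes h: "h \<in> Gamma_fun" and \<alpha>: "ereal \<alpha> < h x"
  obtains \<psi> c where "\<And>y s. h y \<le> ereal s \<Longrightarrow> dual_apply \<psi> x + c * \<alpha> + 1 \<le> dual_apply \<psi> y + c * s"
    "0 \<le> c"
proof -
  have pr: "\<And>y. h y \<noteq> -\<infinity>" "edom h \<noteq> {}" and lsc: "\<And>r. closed {y. h y \<le> ereal r}"
    and cv: "convex_fun h"
    using h by (auto simp: Gamma_fun_def proper_fun_def lsc_fun_def)
  obtain \<beta> where \<beta>: "\<alpha> < \<beta>" "ereal \<beta> < h x"
    using ereal_dense2[OF \<alpha>] by auto
  define U where "U = (\<lambda>v. x + v) -` (- {y. h y \<le> ereal \<beta>})"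
  have "continuous_on UNIV (\<lambda>v. x + v)"
    by (intro continuous_on_add continuous_on_const continuous_on_id)
  then have "open U" unfolding U_def by (rule open_vimage[rotated]) (simp add: lsc open_Compl)
  moreover have "0 \<in> U" using \<beta>(2) by (simp add: U_def not_le)
  ultimately obtain V where V: "open V" "convex V" "0 \<in> V" "V \<subseteq> U" using locally_convex by blast
  obtain p where p: "sublin p" "\<And>v. 0 \<le> p v" "\<And>v. v \<in> V \<Longrightarrow> p v \<le> 1" "\<And>v. p v < 1 \<Longrightarrow> v \<in> V"
    using gauge_sublin[OF V(1-3)] by metis
  \<comment> \<open>\<open>P (y - x, s - \<alpha>) < 1\<close> would force both
    \<open>h y > \<beta>\<close> and \<open>s < \<beta>\<close>, which excludes points of the
    epigraph.\<close>
  define P where "P = (\<lambda>(v, s). p v + \<bar>s\<bar> / (\<beta> - \<alpha>))"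
  have P: "sublin P"
  proof (rule sublinI)
    fix a b :: "'a \<times> real"
    have "\<bar>snd a + snd b\<bar> / (\<beta> - \<alpha>) \<le> \<bar>snd a\<bar> / (\<beta> - \<alpha>) + \<bar>snd b\<bar> / (\<beta> - \<alpha>)"
      using \<beta>(1) by (simp add: add_divide_distrib[symmetric] divide_right_mono)
    then show "P (a + b) \<le> P a + P b"
      using sublin_add[OF p(1), of "fst a" "fst b"] by (simp add: P_def split_beta)
  next
    fix c :: real and a :: "'a \<times> real" assume "0 < c"
    then show "P (c *\<^sub>R a) \<le> c * P a"
      using sublin_scale_le[OF p(1), of c "fst a"]
        by (simp add: P_def split_beta abs_mult algebra_simps)
  qed
  define A where "A = (\<lambda>a. a - (x, \<alpha>)) ` epi h"
  have cvA: "convex A" unfolding A_def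
    by (rule convex_translation_subtract[OF convex_fun_epi[OF cv]])
  obtain x0 where "h x0 < \<infinity>" using pr(2) by (auto simp: edom_def)
  then obtain r0 where "h x0 \<le> ereal r0" using pr(1)[of x0] by (cases "h x0") auto
  then have neA: "A \<noteq> {}" by (auto simp: A_def epi_def)
  have PA: "1 \<le> P a" if a: "a \<in> A" for a
  proof (rule ccontr)
    assume "\<not> 1 \<le> P a"
    moreover obtain y s where ys: "a = (y - x, s - \<alpha>)" "h y \<le> ereal s" using a
      by (auto simp: A_def epi_def)
    ultimately have lt: "p (y - x) + \<bar>s - \<alpha>\<bar> / (\<beta> - \<alpha>) < 1" by (simp add: P_def)
    moreover have "0 \<le> \<bar>s - \<alpha>\<bar> / (\<beta> - \<alpha>)" using \<beta>(1) by simp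
    ultimately have "p (y - x) < 1" by linarith
    then have "y - x \<in> U" using p(4) V(4) by blast
    then have "ereal \<beta> < h y" by (simp add: U_def not_le)
    then have "\<beta> < s" using ys(2) less_le_trans by fastforce
    then have "1 \<le> \<bar>s - \<alpha>\<bar> / (\<beta> - \<alpha>)" using \<beta>(1) by (simp add: le_divide_eq)
    with lt p(2)[of "y - x"] show False by linarith
  qed
  obtain l where l: "linear l" "\<And>a. l a \<le> P a" "\<And>a. a \<in> A \<Longrightarrow> 1 \<le> l a"
    using sublin_separation[OF P cvA neA PA] by blast
  have l1: "linear (\<lambda>v. l (v, 0))"
  proof (rule linearI)
    show "l (a + b, 0) = l (a, 0) + l (b, 0)" for a b using linear_add[OF l(1), of "(a, 0)"
      "(b, 0)"] by simp
    show "l (c *\<^sub>R a, 0) = c *\<^sub>R l (a, 0)" for c a using linear_scale[OF l(1), of c "(a, 0)"]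
      by simp
  qed
  have "l (v, 0) \<le> 1" if "v \<in> V" for v using l(2)[of "(v, 0)"] p(3)[OF that] by (simp add: P_def)
  then have "continuous_on UNIV (\<lambda>v. l (v, 0))"
    by (rule linear_continuous_if_bounded_on_nhd[OF l1 V(1,3)])
  then obtain \<psi> where \<psi>: "dual_apply \<psi> = (\<lambda>v. l (v, 0))" using dual_of_linear[OF l1] by blast
  define c where "c = l (0, 1)"
  have lsplit: "l (v, s) = dual_apply \<psi> v + c * s" for v s
    using linear_add[OF l(1), of "(v, 0)" "s *\<^sub>R (0, 1)"] linear_scale[OF l(1), of s "(0, 1)"]
      by (simp add: \<psi> c_def)
  have main: "dual_apply \<psi> x + c * \<alpha> + 1 \<le> dual_apply \<psi> y + c * s" if "h y \<le> ereal s" for y s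
  proof -
    have "(y - x, s - \<alpha>) \<in> A" using that by (force simp: A_def epi_def)
    from l(3)[OF this] show ?thesis by (simp add: lsplit dual_apply_simps algebra_simps)
  qed
  have "0 \<le> c"
  proof (rule ccontr)
    assume c: "\<not> 0 \<le> c"
    define d where "d = dual_apply \<psi> x0 + c * r0 - (dual_apply \<psi> x + c * \<alpha>)"
    have "h x0 \<le> ereal (r0 + \<bar>d\<bar> / (- c))"
      \<comment> \<open>With \<open>c < 0\<close>, raising the height over \<open>x0\<close> by
        \<open>\<bar>d\<bar> / (- c)\<close> lowers the functional far enough to violate
        \<open>main\<close>.\<close>
      using \<open>h x0 \<le> ereal r0\<close> c
        by (elim order_trans) (auto simp: divide_nonneg_neg divide_nonpos_neg)
    moreover have "c * (r0 + \<bar>d\<bar> / (- c)) = c * r0 - \<bar>d\<bar>" using c by (simp add: algebra_simps)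
    ultimately show False using main[of x0 "r0 + \<bar>d\<bar> / (- c)"] d_def by linarith
  qed
  with main show thesis using that by blast
qed

text \<open>The separating hyperplane may be vertical. Adding a large multiple of it to any affine
  minorant, available where \<open>h\<close> is finite, makes it non-vertical.\<close>

lemma Gamma_fun_affine_minorant:
  fixes h :: "'a::hausdorff_lcs \<Rightarrow> ereal"
  assumes h: "h \<in> Gamma_fun" and \<alpha>: "ereal \<alpha> < h x"
  obtains \<phi> r where "(\<phi>, r) \<in> epi (fenchel_conj h)" "\<alpha> < dual_apply \<phi> x - r"
proof -
  have pr: "\<And>y. h y \<noteq> -\<infinity>" "edom h \<noteq> {}" using h by (auto simp: Gamma_fun_def proper_fun_def)
  have leI: "ereal a \<le> h y" if "\<And>s. h y \<le> ereal s \<Longrightarrow> a \<le> s" for a y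
    using that pr(1)[of y] by (cases "h y") auto
  obtain x0 where "h x0 < \<infinity>" using pr(2) by (auto simp: edom_def)
  then obtain r0 where r0: "h x0 = ereal r0" using pr(1)[of x0] by (cases "h x0") auto
  then have "ereal (r0 - 1) < h x0" by simp
  from Gamma_fun_separation[OF h this]
  obtain \<psi>0 c0 where s0: "\<And>y s. h y \<le> ereal s \<Longrightarrow>
      dual_apply \<psi>0 x0 + c0 * (r0 - 1) + 1 \<le> dual_apply \<psi>0 y + c0 * s" "0 \<le> c0" by metis
  \<comment> \<open>Where \<open>h\<close> is finite the hyperplane cannot be vertical: inserting
    the epigraph point \<open>(x0, r0)\<close> itself gives \<open>c0 \<ge> 1\<close>.\<close>
  have c0: "0 < c0" using s0(1)[of x0 r0] r0 by (simp add: algebra_simps)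
  define \<phi>0 where "\<phi>0 = (- 1 / c0) *\<^sub>R \<psi>0"
  define q where "q = - (dual_apply \<psi>0 x0 + c0 * (r0 - 1) + 1) / c0"
  have min0: "dual_apply \<phi>0 y - q \<le> s" if "h y \<le> ereal s" for y s
    using s0(1)[OF that] c0 by (simp add: \<phi>0_def q_def dual_apply_simps field_simps)
  obtain \<psi> c where s: "\<And>y s. h y \<le> ereal s \<Longrightarrow> dual_apply \<psi> x + c * \<alpha> + 1 \<le> dual_apply \<psi> y + c * s"
    "0 \<le> c"
    using Gamma_fun_separation[OF h \<alpha>] by metis
  \<comment> \<open>\<open>N\<close> times the separation inequality is added to the minorant
    \<open>\<phi>0 - q\<close>. This size lifts the value at \<open>x\<close> above
    \<open>D * \<alpha>\<close>, and dividing by \<open>D = 1 + N * c\<close> normalizes the height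
    coefficient to 1.\<close>
  define N where "N = \<bar>\<alpha> - dual_apply \<phi>0 x + q\<bar> + 1"
  have N: "0 < N" "\<alpha> - dual_apply \<phi>0 x + q < N" unfolding N_def by linarith+
  define D where "D = 1 + N * c"
  have D: "0 < D" using N s(2) by (simp add: D_def add_pos_nonneg)
  define \<phi> where "\<phi> = (1 / D) *\<^sub>R (\<phi>0 - N *\<^sub>R \<psi>)"
  define r where "r = (q - N * (dual_apply \<psi> x + c * \<alpha> + 1)) / D"
  have \<phi>r: "dual_apply \<phi> y - r =
      (dual_apply \<phi>0 y - q + N * (dual_apply \<psi> x + c * \<alpha> + 1 - dual_apply \<psi> y)) / D" for y
    by (simp add: \<phi>_def r_def dual_apply_simps diff_divide_distrib add_divide_distrib algebra_simps)
  show thesis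
  proof
    have "dual_apply \<phi> y - r \<le> t" if t: "h y \<le> ereal t" for y t
    proof -
      have "N * (dual_apply \<psi> x + c * \<alpha> + 1 - dual_apply \<psi> y) \<le> N * (c * t)"
        using s(1)[OF t] N by (intro mult_left_mono) auto
      with min0[OF t] show ?thesis using D by (simp add: \<phi>r divide_le_eq D_def algebra_simps)
    qed
    then show "(\<phi>, r) \<in> epi (fenchel_conj h)" by (auto simp: epi_fenchel_conj_iff intro!: leI)
    show "\<alpha> < dual_apply \<phi> x - r"
      using N D by (simp add: \<phi>r less_divide_eq) (simp add: D_def algebra_simps)
  qed
qed

text \<open>Some affine minorant beats any level below \<open>h x\<close>. This is the
  Fenchel-Moreau theorem in the form needed here: sublevel sets become intersections of
  half-spaces.\<close>

lemma Gamma_fun_le_iff: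
  assumes h: "h \<in> Gamma_fun"
  shows "h x \<le> ereal a \<longleftrightarrow> (\<forall>(\<phi>, r)\<in>epi (fenchel_conj h). dual_apply \<phi> x - r \<le> a)"
proof
  assume "h x \<le> ereal a"
  then show "\<forall>(\<phi>, r)\<in>epi (fenchel_conj h). dual_apply \<phi> x - r \<le> a"
    by (auto simp: epi_fenchel_conj_iff) (metis ereal_less_eq(3) order_trans)
next
  assume le: "\<forall>(\<phi>, r)\<in>epi (fenchel_conj h). dual_apply \<phi> x - r \<le> a"
  show "h x \<le> ereal a"
  proof (rule ccontr)
    assume "\<not> h x \<le> ereal a"
    then have "ereal a < h x" by simp
    from Gamma_fun_affine_minorant[OF h this] obtain \<phi> r where
      "(\<phi>, r) \<in> epi (fenchel_conj h)" "a < dual_apply \<phi> x - r" by metis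
    with le show False by fastforce
  qed
qed

text \<open>The indicator function of \<open>{0}\<close> lies in \<open>Gamma_fun\<close> because
  points are closed. If no functional tells \<open>d\<close> from 0, neither do its affine
  minorants, hence neither does the indicator itself.\<close>

lemma dual_separates_zero:
  fixes d :: "'a::hausdorff_lcs"
  assumes "\<And>\<phi>. dual_apply \<phi> d = 0"
  shows "d = 0"
proof (rule ccontr)
  assume d: "d \<noteq> 0"
  define h :: "'a \<Rightarrow> ereal" where "h x = (if x = 0 then 0 else \<infinity>)" for x
  have "{x. h x \<le> ereal r} = (if 0 \<le> r then {0} else {})" for r by (auto simp: h_def zero_ereal_def)
  then have "lsc_fun h" by (simp add: lsc_fun_def)
  moreover have "proper_fun h" by (auto simp: proper_fun_def h_def edom_def)
  moreover have "convex_fun h" by (auto simp: convex_fun_def h_def)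
  ultimately have h: "h \<in> Gamma_fun" by (simp add: Gamma_fun_def)
  have "h d \<le> ereal 0 \<longleftrightarrow> h 0 \<le> ereal 0"
    by (simp only: Gamma_fun_le_iff[OF h] assms dual_apply_simps)
  with d show False by (simp add: h_def)
qed

subsection \<open>Closure of the union of the epigraphs\<close>

text \<open>Basic neighbourhoods are described by finite sums of absolute values because these are
  sublinear and can enter the separation argument on the dual. The same form serves the weak
  topology.\<close>

lemma open_fun_contains_l1_ball:
  fixes U :: "('b \<Rightarrow> real) set"
  assumes "open U" "g \<in> U"
  obtains F e where "finite F" "0 < e" "\<And>h. (\<Sum>b\<in>F. \<bar>h b - g b\<bar>) < e \<Longrightarrow> h \<in> U"
proof -
  have "openin (product_topology (\<lambda>_. euclidean) UNIV) U"
    using assms(1) by (simp add: euclidean_product_topology)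
  from product_topology_open_contains_basis[OF this assms(2)]
  obtain X where X: "g \<in> Pi\<^sub>E UNIV X" "\<And>b. open (X b)" "finite {b. X b \<noteq> UNIV}" "Pi\<^sub>E UNIV X \<subseteq> U"
    by auto
  have "\<exists>e>0. ball (g b) e \<subseteq> X b" for b using X(1,2) by (auto simp: open_contains_ball PiE_iff)
  then obtain E where E: "\<And>b. 0 < E b" "\<And>b. ball (g b) (E b) \<subseteq> X b" by metis
  define F where "F = {b. X b \<noteq> UNIV}"
  define e where "e = Min (insert 1 (E ` F))"
  have F: "finite F" using X(3) by (simp add: F_def)
  show thesis
  proof (rule that[OF F])
    show "0 < e" using F E(1) by (auto simp: e_def)
    fix h assume h: "(\<Sum>b\<in>F. \<bar>h b - g b\<bar>) < e"
    have "h b \<in> X b" for b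
    proof (cases "b \<in> F")
      case True
      have "\<bar>h b - g b\<bar> \<le> (\<Sum>b\<in>F. \<bar>h b - g b\<bar>)" by (rule member_le_sum) (use F True in auto)
      moreover have "e \<le> E b" unfolding e_def using F True by (intro Min_le) auto
      ultimately have "h b \<in> ball (g b) (E b)" using h
        by (simp add: dist_real_def abs_minus_commute)
      then show ?thesis using E(2) by blast
    qed (auto simp: F_def)
    then show "h \<in> U" using X(4) by (auto simp: PiE_iff)
  qed
qed

section \<open>The weak-star topology and functionals on the dual\<close>

lemma open_dual_iff:
  "open U \<longleftrightarrow> (\<exists>V. open V \<and> U = dual_apply -` V)"
  by (simp add: open_continuous_dual_def openin_pullback_topology)

lemma continuous_on_dual_eval: "continuous_on UNIV (\<lambda>\<phi>. dual_apply \<phi> x)"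
proof -
  have "open ((\<lambda>\<phi>. dual_apply \<phi> x) -` W)" if "open W" for W
  proof -
    have "continuous_on UNIV (\<lambda>g :: 'a \<Rightarrow> real. g x)" by (rule continuous_on_product_coordinates)
    then have "open ((\<lambda>g :: 'a \<Rightarrow> real. g x) -` W)" using that by (rule open_vimage[rotated])
    then show ?thesis by (auto simp: open_dual_iff vimage_def)
  qed
  then show ?thesis by (simp add: continuous_on_open_vimage)
qed

text \<open>A functional controlled by finitely many evaluations is a combination of them; this is
  how separation on the dual produces a point of the original space.\<close>

lemma functional_on_dual_is_eval:
  fixes l :: "'a::hausdorff_lcs continuous_dual \<Rightarrow> real"
  assumes "finite S" "linear l" "\<And>\<phi>. \<forall>x\<in>S. dual_apply \<phi> x = 0 \<Longrightarrow> l \<phi> = 0"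
  shows "\<exists>x. \<forall>\<phi>. l \<phi> = dual_apply \<phi> x"
  using assms
proof (induction S arbitrary: l rule: finite_induct)
  case empty
  then show ?case by (intro exI[of _ 0]) (simp add: dual_apply_simps)
next
  case (insert z S)
  show ?case
  proof (cases "\<exists>v. (\<forall>x\<in>S. dual_apply v x = 0) \<and> dual_apply v z \<noteq> 0")
    case False
    then show ?thesis using insert by (intro insert.IH) auto
  next
    case True
    then obtain v where v: "\<forall>x\<in>S. dual_apply v x = 0" "dual_apply v z \<noteq> 0" by blast
    \<comment> \<open>\<open>v\<close> vanishes on \<open>S\<close> but not at \<open>z\<close>, so
      any \<open>\<phi>\<close> vanishing on \<open>S\<close> also vanishes at \<open>z\<close>
      after subtracting a multiple of \<open>v\<close>. Hence \<open>k\<close> is the coefficient of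
      the evaluation at \<open>z\<close>.\<close>
    define k where "k = l v / dual_apply v z"
    have "\<exists>x. \<forall>\<phi>. l \<phi> - k * dual_apply \<phi> z = dual_apply \<phi> x"
    proof (rule insert.IH)
      show "linear (\<lambda>\<phi>. l \<phi> - k * dual_apply \<phi> z)"
        by (rule linearI)
          (simp_all add: linear_add[OF insert.prems(1)] linear_scale[OF insert.prems(1)] dual_apply_simps algebra_simps)
      fix \<phi> assume \<phi>: "\<forall>x\<in>S. dual_apply \<phi> x = 0"
      have "l (\<phi> - (dual_apply \<phi> z / dual_apply v z) *\<^sub>R v) = 0"
        using \<phi> v by (intro insert.prems(2)) (auto simp: dual_apply_simps)
      then show "l \<phi> - k * dual_apply \<phi> z = 0"
        by (simp add: linear_diff[OF insert.prems(1)] linear_scale[OF insert.prems(1)] k_def)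
    qed
    then obtain x where "\<And>\<phi>. l \<phi> - k * dual_apply \<phi> z = dual_apply \<phi> x" by blast
    then have "l \<phi> = dual_apply \<phi> (x + k *\<^sub>R z)" for \<phi> by (simp add: dual_apply_simps diff_eq_eq)
    then show ?thesis by blast
  qed
qed

section \<open>Weighted sums and the union of their epigraphs\<close>

lemma epi_mono: "(a, r) \<in> epi h \<Longrightarrow> r \<le> s \<Longrightarrow> (a, s) \<in> epi h"
  by (auto simp: epi_def intro: order_trans)

lemma unit_simplex_nonneg: "l \<in> unit_simplex I \<Longrightarrow> 0 \<le> l i"
  by (cases "l i = 0") (auto simp: unit_simplex_def supp_def)

text \<open>Indices outside the support contribute 0 even where \<open>f i y\<close> is infinite,
  since \<open>0 * \<infinity> = 0\<close> in \<open>ereal\<close>.\<close>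

lemma weighted_sum_superset:
  assumes "finite S" "supp l \<subseteq> S"
  shows "weighted_sum l f y = (\<Sum>i\<in>S. ereal (l i) * f i y)"
  unfolding weighted_sum_def
  by (rule sum.mono_neutral_left) (use assms in \<open>auto simp: supp_def zero_ereal_def[symmetric]\<close>)

lemma weighted_sum_le:
  assumes l: "l \<in> unit_simplex I" and le: "\<And>i. i \<in> I \<Longrightarrow> f i x \<le> F" and F: "F \<noteq> -\<infinity>"
  shows "weighted_sum l f x \<le> F"
proof (cases F)
  case (real r)
  have "weighted_sum l f x \<le> (\<Sum>i\<in>supp l. ereal (l i) * ereal r)"
    unfolding weighted_sum_def
    by (intro sum_mono ereal_mult_left_mono) (use l le real in \<open>auto simp: unit_simplex_def\<close>)
  also have "\<dots> = ereal r" using l by (simp add: unit_simplex_def sum_distrib_right[symmetric])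
  finally show ?thesis using real by simp
qed (use F in auto)

lemma point_mass_in_unit_simplex:
  assumes "i \<in> I"
  obtains l where "l \<in> unit_simplex I" "weighted_sum l f = f i"
proof
  let ?l = "\<lambda>j. if j = i then 1 else (0::real)"
  have "supp ?l = {i}" by (auto simp: supp_def)
  then show "?l \<in> unit_simplex I" "weighted_sum ?l f = f i"
    using assms by (auto simp: unit_simplex_def weighted_sum_def one_ereal_def[symmetric])
qed

text \<open>Affine minorants for weights \<open>l\<close> and \<open>m\<close> combine into one for
  \<open>(1 - t) l + t m\<close>. For \<open>0 < t < 1\<close> the support of the new weights is the
  union of the two supports, so an infinite value at any index there makes the new sum infinite;
  otherwise all terms are real.\<close>

lemma convex_Union_epi_weighted_sum:
  assumes f: "\<And>i x. i \<in> I \<Longrightarrow> f i x \<noteq> -\<infinity>"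
  shows "convex (\<Union>l\<in>unit_simplex I. epi (fenchel_conj (weighted_sum l f)))" (is "convex ?A")
  unfolding convex_alt
proof (intro ballI allI impI)
  fix a b and t :: real
  assume ab: "a \<in> ?A" "b \<in> ?A" and t: "0 \<le> t \<and> t \<le> 1"
  consider "t = 0" | "t = 1" | "0 < t" "t < 1" using t by fastforce
  then show "(1 - t) *\<^sub>R a + t *\<^sub>R b \<in> ?A"
  proof cases
    case 3
    have *: "\<exists>l \<phi> r. a = (\<phi>, r) \<and> l \<in> unit_simplex I \<and> (\<forall>y. ereal (dual_apply \<phi> y - r) \<le> weighted_sum l f y)"
      if aA: "a \<in> ?A" for a
    proof -
      obtain l where "l \<in> unit_simplex I" "a \<in> epi (fenchel_conj (weighted_sum l f))" using aA
        by blast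
      then show ?thesis by (cases a) (auto simp: epi_fenchel_conj_iff)
    qed
    obtain l \<phi> r where a: "a = (\<phi>, r)" "l \<in> unit_simplex I"
      "\<And>y. ereal (dual_apply \<phi> y - r) \<le> weighted_sum l f y"
      using *[OF ab(1)] by blast
    obtain m \<psi> s where b: "b = (\<psi>, s)" "m \<in> unit_simplex I"
      "\<And>y. ereal (dual_apply \<psi> y - s) \<le> weighted_sum m f y"
      using *[OF ab(2)] by blast
    define k where "k i = (1 - t) * l i + t * m i" for i
    define S where "S = supp l \<union> supp m"
    have S: "finite S" "supp l \<subseteq> S" "supp m \<subseteq> S" "S \<subseteq> I" using a(2) b(2)
      by (auto simp: S_def unit_simplex_def)
    have nn: "0 \<le> l i" "0 \<le> m i" for i using unit_simplex_nonneg a(2) b(2) by metis+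
    have knn: "0 \<le> k i" for i using nn[of i] 3 by (simp add: k_def)
    have "k i = 0 \<longleftrightarrow> l i = 0 \<and> m i = 0" for i
      using nn[of i] 3 by (simp add: k_def add_nonneg_eq_0_iff)
    then have kS: "supp k = S" by (auto simp: S_def supp_def)
    have kpos: "0 < k i" if "i \<in> S" for i
      using that knn[of i] unfolding kS[symmetric] by (simp add: supp_def less_le)
    have "sum l S = sum l (supp l)" "sum m S = sum m (supp m)"
      by (rule sum.mono_neutral_right; use S in \<open>simp add: supp_def\<close>)+
    then have "sum l S = 1" "sum m S = 1" using a(2) b(2) by (simp_all add: unit_simplex_def)
    then have "sum k S = 1" by (simp add: k_def sum.distrib sum_distrib_left[symmetric])
    then have k: "k \<in> unit_simplex I" using S knn by (simp add: unit_simplex_def kS)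
    have "ereal ((1 - t) * (dual_apply \<phi> y - r) + t * (dual_apply \<psi> y - s)) \<le> weighted_sum k f y" for y
    proof (cases "\<exists>i\<in>S. f i y = \<infinity>")
      case True
      then obtain i where i: "i \<in> S" "f i y = \<infinity>" by blast
      then have "weighted_sum k f y = \<infinity>" using kpos[OF i(1)] S unfolding weighted_sum_def kS
        by (auto simp: sum_Pinfty)
      then show ?thesis by simp
    next
      case False
      define g where "g i = real_of_ereal (f i y)" for i
      have g: "f i y = ereal (g i)" if "i \<in> S" for i
        using False f[of i y] that S by (cases "f i y") (auto simp: g_def)
      have ws: "weighted_sum n f y = ereal (\<Sum>i\<in>S. n i * g i)" if "supp n \<subseteq> S" for n
        unfolding weighted_sum_superset[OF S(1) that] by (simp add: g)
      have "dual_apply \<phi> y - r \<le> (\<Sum>i\<in>S. l i * g i)" "dual_apply \<psi> y - s \<le> (\<Sum>i\<in>S. m i * g i)"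
        using a(3)[of y] b(3)[of y] S by (simp_all add: ws)
      then have "(1 - t) * (dual_apply \<phi> y - r) + t * (dual_apply \<psi> y - s)
          \<le> (1 - t) * (\<Sum>i\<in>S. l i * g i) + t * (\<Sum>i\<in>S. m i * g i)"
        using 3 by (intro add_mono mult_left_mono) auto
      also have "\<dots> = (\<Sum>i\<in>S. k i * g i)"
        by (simp add: k_def sum_distrib_left sum.distrib[symmetric] algebra_simps)
      finally show ?thesis by (simp add: ws kS)
    qed
    then have "(1 - t) *\<^sub>R a + t *\<^sub>R b \<in> epi (fenchel_conj (weighted_sum k f))"
      by (simp add: a b epi_fenchel_conj_iff dual_apply_simps algebra_simps)
    with k show ?thesis by blast
  qed (use ab in auto)
qed

text \<open>Pools the minorants of all members; both the decomposition of the minimizers and the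
  duality argument use the supremum in this form.\<close>

lemma sup_fun_le_iff:
  assumes "\<forall>i\<in>I. f i \<in> Gamma_fun"
  shows "sup_fun I f x \<le> ereal a \<longleftrightarrow>
    (\<forall>(\<phi>, r)\<in>(\<Union>i\<in>I. epi (fenchel_conj (f i))). dual_apply \<phi> x - r \<le> a)"
  using Gamma_fun_le_iff assms by (fastforce simp: sup_fun_def SUP_le_iff)

text \<open>Otherwise some \<open>(\<phi>, r) \<mapsto> \<phi> x + c r\<close> with
  \<open>c \<ge> 0\<close> strictly separates \<open>(0, - m)\<close> from \<open>A\<close>. As
  \<open>A\<close> contains all affine minorants of the \<open>f i\<close>, moving from
  \<open>x0\<close> against \<open>x\<close> and rescaling gives a point where the supremum is below
  \<open>m\<close>.\<close>

lemma minus_inf_in_closure: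
  fixes f :: "'i \<Rightarrow> 'a::hausdorff_lcs \<Rightarrow> ereal"
  assumes f: "\<forall>i\<in>I. f i \<in> Gamma_fun" and I: "I \<noteq> {}"
    and x0: "sup_fun I f x0 \<le> ereal \<rho>" and m: "\<And>x. ereal m \<le> sup_fun I f x"
    and A: "convex A" "\<And>\<phi> r s. (\<phi>, r) \<in> A \<Longrightarrow> r \<le> s \<Longrightarrow> (\<phi>, s) \<in> A"
    and epiA: "\<And>i. i \<in> I \<Longrightarrow> epi (fenchel_conj (f i)) \<subseteq> A"
  shows "(0, - m) \<in> closure A"
proof (rule ccontr)
  assume "(0, - m) \<notin> closure A"
  then have "open (- closure A)" "(0, - m) \<in> - closure A" by auto
  then obtain V W where VW: "open V" "open W" "(0, - m) \<in> V \<times> W" "V \<times> W \<subseteq> - closure A"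
    by (rule open_prod_elim)
  obtain V' where V': "open V'" "V = dual_apply -` V'" using VW(1) open_dual_iff by blast
  have "dual_apply 0 \<in> V'" using VW(3) V'(2) by simp
  from open_fun_contains_l1_ball[OF V'(1) this] obtain F e1 where
    F: "finite F" "0 < e1" "\<And>h. (\<Sum>x\<in>F. \<bar>h x - dual_apply 0 x\<bar>) < e1 \<Longrightarrow> h \<in> V'" by metis
  obtain e2 where e2: "0 < e2" "ball (- m) e2 \<subseteq> W" using VW(2,3) by (auto simp: open_contains_ball)
  define e where "e = min e1 e2"
  have e: "0 < e" "e \<le> e1" "e \<le> e2" using F e2 by (auto simp: e_def)
  define p where "p = (\<lambda>(\<phi>, r). (\<Sum>x\<in>F. \<bar>dual_apply \<phi> x\<bar>) + \<bar>r\<bar>)"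
  have p: "sublin p"
  proof (rule sublinI)
    fix a b :: "'a continuous_dual \<times> real"
    have "(\<Sum>x\<in>F. \<bar>dual_apply (fst a + fst b) x\<bar>) \<le> (\<Sum>x\<in>F. \<bar>dual_apply (fst a) x\<bar> + \<bar>dual_apply (fst b) x\<bar>)"
      by (intro sum_mono) (simp add: dual_apply_simps)
    then show "p (a + b) \<le> p a + p b" by (simp add: p_def split_beta sum.distrib)
  next
    fix c :: real and a :: "'a continuous_dual \<times> real" assume "0 < c"
    then show "p (c *\<^sub>R a) \<le> c * p a"
      by (simp add: p_def split_beta dual_apply_simps abs_mult sum_distrib_left algebra_simps)
  qed
  have ninf: "\<And>i x. i \<in> I \<Longrightarrow> f i x \<noteq> -\<infinity>" using f by (auto simp: Gamma_fun_def proper_fun_def)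
  have cvA: "convex ((\<lambda>a. a - (0, - m)) ` A)"
    by (rule convex_translation_subtract[OF A(1)])
  obtain i0 where i0: "i0 \<in> I" using I by blast
  obtain \<phi>0 r0 where \<phi>0: "(\<phi>0, r0) \<in> A"
  proof -
    have "\<exists>\<alpha>. ereal \<alpha> < f i0 x0"
    proof (cases "f i0 x0")
      case (real r)
      then show ?thesis by (intro exI[of _ "r - 1"]) simp
    qed (use ninf[OF i0, of x0] in auto)
    then obtain \<alpha> where "ereal \<alpha> < f i0 x0" ..
    from Gamma_fun_affine_minorant[OF bspec[OF f i0] this] obtain \<phi> r
      where "(\<phi>, r) \<in> epi (fenchel_conj (f i0))" by metis
    then show ?thesis using epiA[OF i0] that by blast
  qed
  have pA: "e \<le> p a" if aA: "a \<in> (\<lambda>a. a - (0, - m)) ` A" for a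
  proof (rule ccontr)
    assume lt: "\<not> e \<le> p a"
    obtain b where b: "b \<in> A" "a = b - (0, - m)" using aA by blast
    obtain \<phi> r where "b = (\<phi>, r)" by (cases b)
    with b have a: "(\<phi>, r) \<in> A" "a = (\<phi>, r + m)" by simp_all
    have "0 \<le> (\<Sum>x\<in>F. \<bar>dual_apply \<phi> x\<bar>)" by (intro sum_nonneg) auto
    moreover have "(\<Sum>x\<in>F. \<bar>dual_apply \<phi> x\<bar>) + \<bar>r + m\<bar> < e" using lt by (simp add: p_def a(2))
    ultimately have "(\<Sum>x\<in>F. \<bar>dual_apply \<phi> x\<bar>) < e1" "\<bar>r + m\<bar> < e2" using e by linarith+
    then have "\<phi> \<in> V" "r \<in> W"
      using F(3)[of "dual_apply \<phi>"] V'(2) e2(2)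
        by (auto simp: dual_apply_simps dist_real_def subset_iff abs_minus_commute)
    then have "(\<phi>, r) \<notin> closure A" using VW(4) by blast
    with subsetD[OF closure_subset a(1)] show False by simp
  qed
  obtain l where l: "linear l" "\<And>a. l a \<le> p a" "\<And>a. a \<in> (\<lambda>a. a - (0, - m)) ` A \<Longrightarrow> e \<le> l a"
    using sublin_separation[OF p cvA _ pA] \<phi>0 by blast
  have l1: "linear (\<lambda>\<phi>. l (\<phi>, 0))"
  proof (rule linearI)
    show "l (a + b, 0) = l (a, 0) + l (b, 0)" for a b using linear_add[OF l(1), of "(a, 0)"
      "(b, 0)"] by simp
    show "l (c *\<^sub>R a, 0) = c *\<^sub>R l (a, 0)" for c a using linear_scale[OF l(1), of c "(a, 0)"]
      by simp
  qed
  \<comment> \<open>The bound by \<open>p\<close>, used for \<open>\<phi>\<close> and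
    \<open>- \<phi>\<close>, makes the functional vanish where all evaluations at \<open>F\<close>
    do, so it is itself an evaluation.\<close>
  have "l (\<phi>, 0) = 0" if "\<forall>x\<in>F. dual_apply \<phi> x = 0" for \<phi>
    using l(2)[of "(\<phi>, 0)"] l(2)[of "(- \<phi>, 0)"] that linear_neg[OF l1, of \<phi>]
      by (simp add: p_def dual_apply_simps)
  then obtain x where x: "\<And>\<phi>. l (\<phi>, 0) = dual_apply \<phi> x"
    using functional_on_dual_is_eval[OF F(1) l1] by blast
  define c where "c = l (0, 1)"
  have lsplit: "l (\<phi>, s) = dual_apply \<phi> x + c * s" for \<phi> s
    using linear_add[OF l(1), of "(\<phi>, 0)" "s *\<^sub>R (0, 1)"] linear_scale[OF l(1), of s "(0, 1)"]
      by (simp add: x c_def)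
  have main: "e \<le> dual_apply \<phi> x + c * (r + m)" if "(\<phi>, r) \<in> A" for \<phi> r
  proof -
    have "(\<phi>, r + m) \<in> (\<lambda>a. a - (0, - m)) ` A" using that by force
    from l(3)[OF this] show ?thesis by (simp add: lsplit)
  qed
  have c: "0 \<le> c"
  proof (rule ccontr)
    assume c: "\<not> 0 \<le> c"
    \<comment> \<open>\<open>A\<close> is closed under raising the second component, so a negative
      \<open>c\<close> would push the functional below \<open>e\<close>.\<close>
    define d where "d = \<bar>dual_apply \<phi>0 x + c * (r0 + m)\<bar> / (- c)"
    have "0 \<le> d" using c by (simp add: d_def divide_nonneg_neg)
    then have "(\<phi>0, r0 + d) \<in> A" using A(2)[OF \<phi>0] by simp
    moreover have "c * d = - \<bar>dual_apply \<phi>0 x + c * (r0 + m)\<bar>" using c by (simp add: d_def)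
    ultimately show False using main[of \<phi>0 "r0 + d"] e(1) by (simp add: algebra_simps)
  qed
  \<comment> \<open>\<open>N\<close> copies of the separation inequality are added to the one at
    \<open>x0\<close>. Since \<open>N * e\<close> is at least \<open>\<rho> - m + 1\<close>, the
    bound drops from \<open>\<rho>\<close> below \<open>m\<close>; \<open>D = 1 + N * c\<close> is
    the total weight of \<open>r\<close> and is positive even if \<open>c = 0\<close>.\<close>
  define N where "N = (\<bar>\<rho> - m\<bar> + 1) / e"
  have N: "0 \<le> N" "N * e = \<bar>\<rho> - m\<bar> + 1" using e by (simp_all add: N_def)
  define D where "D = 1 + N * c"
  have D: "0 < D" using N(1) c by (simp add: D_def add_pos_nonneg)
  define z where "z = (1 / D) *\<^sub>R (x0 - N *\<^sub>R x)"
  have "sup_fun I f z \<le> ereal (m - 1 / D)"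
    unfolding sup_fun_le_iff[OF f]
  proof clarify
    fix \<phi> r i assume i: "i \<in> I" "(\<phi>, r) \<in> epi (fenchel_conj (f i))"
    have "dual_apply \<phi> x0 - r \<le> \<rho>" using x0 i unfolding sup_fun_le_iff[OF f] by blast
    moreover have "N * e \<le> N * (dual_apply \<phi> x + c * (r + m))"
      using main[of \<phi> r] epiA[OF i(1)] i(2) N(1) by (intro mult_left_mono) auto
    ultimately have "dual_apply \<phi> (x0 - N *\<^sub>R x) - D * r \<le> D * m - 1"
      using N(2) by (simp add: dual_apply_simps D_def algebra_simps)
    then have "dual_apply \<phi> (x0 - N *\<^sub>R x) \<le> (m - 1 / D + r) * D" using D
      by (simp add: algebra_simps)
    then have "dual_apply \<phi> (x0 - N *\<^sub>R x) / D \<le> m - 1 / D + r" using D by (simp add: divide_le_eq)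
    moreover have "dual_apply \<phi> z = dual_apply \<phi> (x0 - N *\<^sub>R x) / D"
      unfolding z_def linear_scale[OF linear_dual_apply] by simp
    ultimately show "dual_apply \<phi> z - r \<le> m - 1 / D" by simp
  qed
  with m[of z] have "ereal m \<le> ereal (m - 1 / D)" by (rule order_trans)
  with D show False by simp
qed

subsection \<open>Weak compactness and minimizers\<close>

lemma topspace_weak_topology [simp]: "topspace weak_topology = UNIV"
  by (simp add: weak_topology_def topspace_pullback_topology)

lemma continuous_map_weak_dual_apply: "continuous_map weak_topology euclideanreal (dual_apply \<phi>)"
proof -
  have "continuous_map euclidean euclideanreal (\<lambda>u :: 'a continuous_dual \<Rightarrow> real. u \<phi>)"
    by (simp add: continuous_on_product_coordinates)
  from continuous_map_pullback[OF this, of UNIV "\<lambda>x \<phi>. dual_apply \<phi> x"] show ?thesis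
    by (simp add: weak_topology_def o_def)
qed

lemma continuous_map_into_weak_topology:
  assumes "\<And>\<phi>. continuous_map X euclideanreal (\<lambda>x. dual_apply \<phi> (g x))"
  shows "continuous_map X weak_topology g"
  unfolding weak_topology_def
proof (rule continuous_map_pullback')
  have "continuous_map X (product_topology (\<lambda>_. euclideanreal) UNIV) (\<lambda>x \<phi>. dual_apply \<phi> (g x))"
    using assms by (simp add: continuous_map_componentwise_UNIV)
  then show "continuous_map X euclidean ((\<lambda>x \<phi>. dual_apply \<phi> x) \<circ> g)"
    by (simp add: o_def euclidean_product_topology)
qed simp

lemma continuous_map_weak_homothety:
  "continuous_map weak_topology weak_topology (\<lambda>x. a + c *\<^sub>R (x - a))"
  by (rule continuous_map_into_weak_topology)
    (simp add: dual_apply_simps, intro continuous_intros continuous_map_weak_dual_apply)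

lemma closedin_weak_preimage:
  assumes "continuous_map weak_topology euclideanreal g" "closed W"
  shows "closedin weak_topology {x. g x \<in> W}"
  using closedin_continuous_map_preimage[OF assms(1), of W] assms(2) by simp

lemma weakly_locally_compact_nhd:
  fixes C :: "'a::hausdorff_lcs set"
  assumes "locally_compact_space (subtopology weak_topology C)" "x \<in> C"
  obtains F e K where "finite F" "0 < e" "compactin weak_topology K" "K \<subseteq> C"
    "{y \<in> C. (\<Sum>\<phi>\<in>F. \<bar>dual_apply \<phi> (y - x)\<bar>) \<le> e} \<subseteq> K"
proof -
  obtain U K where UK: "openin (subtopology weak_topology C) U"
    "compactin (subtopology weak_topology C) K" "x \<in> U" "U \<subseteq> K"
    using assms unfolding locally_compact_space_def by fastforce
  obtain T where T: "openin weak_topology T" "U = T \<inter> C" using UK(1)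
    by (auto simp: openin_subtopology)
  obtain V where V: "open V" "T = (\<lambda>x \<phi>. dual_apply \<phi> x) -` V"
    using T(1) by (auto simp: weak_topology_def openin_pullback_topology)
  have "(\<lambda>\<phi>. dual_apply \<phi> x) \<in> V" using UK(3) T(2) V(2) by simp
  from open_fun_contains_l1_ball[OF V(1) this] obtain F e where F: "finite F" "0 < e"
    "\<And>h. (\<Sum>\<phi>\<in>F. \<bar>h \<phi> - dual_apply \<phi> x\<bar>) < e \<Longrightarrow> h \<in> V" by metis
  show thesis
  proof
    \<comment> \<open>Halving the radius turns the strict bound into a non-strict one, so that the
      slice is weakly closed whenever \<open>C\<close> is.\<close>
    show "finite F" "0 < e / 2" using F by auto
    show "compactin weak_topology K" "K \<subseteq> C" using UK(2) by (auto simp: compactin_subtopology)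
    show "{y \<in> C. (\<Sum>\<phi>\<in>F. \<bar>dual_apply \<phi> (y - x)\<bar>) \<le> e / 2} \<subseteq> K"
    proof clarify
      fix y assume y: "y \<in> C" "(\<Sum>\<phi>\<in>F. \<bar>dual_apply \<phi> (y - x)\<bar>) \<le> e / 2"
      then have "(\<Sum>\<phi>\<in>F. \<bar>dual_apply \<phi> y - dual_apply \<phi> x\<bar>) < e" using F(2)
        by (simp add: dual_apply_simps)
      from F(3)[of "\<lambda>\<phi>. dual_apply \<phi> y", OF this] show "y \<in> K" using y(1) T(2) V(2) UK(4) by auto
    qed
  qed
qed

lemma compactin_decseq_Inter_nonempty:
  fixes C :: "nat \<Rightarrow> 'a set"
  assumes "compactin X K" "\<And>n. closedin X (C n)" "\<And>n. K \<inter> C n \<noteq> {}" "decseq C"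
  shows "K \<inter> (\<Inter>n. C n) \<noteq> {}"
proof -
  have "K \<inter> \<Inter>(range C) \<noteq> {}"
  proof (rule compactin_fip[THEN iffD1, OF assms(1), THEN conjunct2, rule_format], intro conjI ballI allI impI)
    show "closedin X D" if "D \<in> range C" for D using that assms(2) by auto
    fix G assume "finite G \<and> G \<subseteq> range C"
    then obtain J where J: "finite J" "G = C ` J" by (metis finite_subset_image)
    \<comment> \<open>Inserting 0 keeps \<open>Max\<close> meaningful when the finite subfamily is
      empty.\<close>
    have "C (Max (insert 0 J)) \<subseteq> C j" if "j \<in> J" for j
      using J(1) that by (intro decseqD[OF assms(4)] Max_ge) auto
    then have "C (Max (insert 0 J)) \<subseteq> \<Inter>G" using J(2) by blast
    then show "K \<inter> \<Inter>G \<noteq> {}" using assms(3) by blast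
  qed
  then show ?thesis by simp
qed

text \<open>Let \<open>p y\<close> be the sum over \<open>F\<close> below. If \<open>D\<close> leaves the compact slice \<open>p \<le> e\<close> arbitrarily far, compactness of \<open>p = e\<close> provides
  a ray in \<open>D\<close>; otherwise a homothetic image of the slice covers \<open>D\<close>.\<close>

lemma compactin_weak_if_no_ray:
  fixes D :: "'a::hausdorff_lcs set"
  assumes D: "convex D" "closedin weak_topology D" "a \<in> D"
    and F: "0 < e" "compactin weak_topology K"
      "{y \<in> D. (\<Sum>\<phi>\<in>F. \<bar>dual_apply \<phi> (y - a)\<bar>) \<le> e} \<subseteq> K"
    and no_ray: "\<And>d. (\<And>t. 0 \<le> t \<Longrightarrow> a + t *\<^sub>R d \<in> D) \<Longrightarrow> d = 0"
  shows "compactin weak_topology D"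
proof -
  define p where "p v = (\<Sum>\<phi>\<in>F. \<bar>dual_apply \<phi> v\<bar>)" for v
  \<comment> \<open>An infinite \<open>F\<close> makes the sum 0 by convention, hence the case
    split.\<close>
  have pcont: "continuous_map weak_topology euclideanreal (\<lambda>y. p (y - a))"
    unfolding p_def dual_apply_simps
    by (cases "finite F") (auto intro!: continuous_intros continuous_map_weak_dual_apply)
  have pscale: "p (t *\<^sub>R v) = t * p v" if "0 \<le> t" for t v
    using that by (simp add: p_def dual_apply_simps abs_mult sum_distrib_left)
  have seg: "a + t *\<^sub>R (y - a) \<in> D" if "y \<in> D" "0 \<le> t" "t \<le> 1" for y t
    using convexD_alt[OF D(1) D(3) that] by (simp add: algebra_simps)
  define S where "S = {y \<in> D. p (y - a) = e}"
  define S' where "S' = {y \<in> D. p (y - a) \<le> e}"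
  have "closedin weak_topology (D \<inter> {y. p (y - a) \<in> {e}})"
    "closedin weak_topology (D \<inter> {y. p (y - a) \<in> {..e}})"
    by (intro closedin_Int D closedin_weak_preimage pcont closed_singleton closed_atMost)+
  moreover have "D \<inter> {y. p (y - a) \<in> {e}} = S" "D \<inter> {y. p (y - a) \<in> {..e}} = S'"
    by (auto simp: S_def S'_def)
  ultimately have "closedin weak_topology S" "closedin weak_topology S'" by simp_all
  moreover have "S' \<subseteq> K" "S \<subseteq> K" using F(3) by (auto simp: S'_def S_def p_def)
  ultimately have S: "compactin weak_topology S" and S': "compactin weak_topology S'"
    using closed_compactin F(2) by blast+
  \<comment> \<open>Points whose segment from \<open>a\<close> can be stretched \<open>n\<close>
    times within \<open>D\<close>. By convexity these sets decrease, and a point of \<open>S\<close>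
    common to all of them would span a ray.\<close>
  define T where "T n = {y. a + real n *\<^sub>R (y - a) \<in> D}" for n
  have Tclosed: "closedin weak_topology (T n)" for n
    using closedin_continuous_map_preimage[OF continuous_map_weak_homothety D(2), of a "real n"]
      by (simp add: T_def)
  have Tray: "a + t *\<^sub>R (y - a) \<in> D" if "y \<in> T n" "0 \<le> t" "t \<le> real n" for y t n
  proof (cases "n = 0")
    case False
    then show ?thesis using seg[of "a + real n *\<^sub>R (y - a)" "t / real n"] that by (simp add: T_def)
  qed (use that D(3) in auto)
  have "decseq T"
  proof (intro decseq_SucI subsetI)
    fix n y assume "y \<in> T (Suc n)"
    from Tray[OF this, of "real n"] show "y \<in> T n" by (simp add: T_def)
  qed
  have "\<exists>n. S \<inter> T n = {}"
  proof (rule ccontr)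
    assume "\<nexists>n. S \<inter> T n = {}"
    then have "S \<inter> (\<Inter>n. T n) \<noteq> {}"
      using compactin_decseq_Inter_nonempty[OF S Tclosed _ \<open>decseq T\<close>] by blast
    then obtain y where y: "y \<in> S" "\<And>n. y \<in> T n" by blast
    have "a + t *\<^sub>R (y - a) \<in> D" if "0 \<le> t" for t
      using Tray[OF y(2) that, of "nat \<lceil>t\<rceil>"] by (simp add: real_nat_ceiling_ge)
    then have "y - a = 0" by (rule no_ray)
    with y(1) F(1) show False by (simp add: S_def p_def dual_apply_simps)
  qed
  then obtain n where n: "S \<inter> T n = {}" by blast
  have n0: "0 < real n + 1" by simp
  \<comment> \<open>The factor \<open>n + 1\<close> is positive even for \<open>n = 0\<close>. If
    \<open>x\<close> shrunk by it still had \<open>p > e\<close>, the segment from \<open>a\<close>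
    to \<open>x\<close> would meet \<open>S\<close> at a parameter \<open>t\<close> with
    \<open>n * t \<le> 1\<close>, hence in a point of \<open>T n\<close>.\<close>
  have "D \<subseteq> (\<lambda>y. a + (real n + 1) *\<^sub>R (y - a)) ` S'"
  proof
    fix x assume x: "x \<in> D"
    define y where "y = a + (1 / (real n + 1)) *\<^sub>R (x - a)"
    have "y \<in> D" unfolding y_def by (rule seg[OF x]) auto
    moreover have "p (y - a) \<le> e"
    proof (rule ccontr)
      assume "\<not> p (y - a) \<le> e"
      moreover have py: "p (y - a) = p (x - a) / (real n + 1)" by (simp add: y_def pscale)
      ultimately have gt: "e * (real n + 1) < p (x - a)" using n0
        by (simp add: not_le pos_less_divide_eq)
      then have px: "0 < p (x - a)" using F(1) n0 by (meson less_trans mult_pos_pos)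
      define t where "t = e / p (x - a)"
      have t: "0 \<le> t" "t * (real n + 1) \<le> 1" using gt px F(1) by (auto simp: t_def divide_le_eq)
      then have t1: "t \<le> 1" "real n * t \<le> 1"
        by (simp_all add: algebra_simps) (smt (verit) mult_nonneg_nonneg of_nat_0_le_iff)+
      define s where "s = a + t *\<^sub>R (x - a)"
      have "s \<in> S" using seg[OF x t(1) t1(1)] px t
        by (simp add: S_def s_def pscale) (simp add: t_def)
      moreover have "s \<in> T n" using seg[OF x _ t1(2)] t by (simp add: T_def s_def)
      ultimately show False using n by blast
    qed
    ultimately have "y \<in> S'" by (simp add: S'_def)
    then show "x \<in> (\<lambda>y. a + (real n + 1) *\<^sub>R (y - a)) ` S'"
      by (rule rev_image_eqI) (simp add: y_def)
  qed
  with image_compactin[OF S' continuous_map_weak_homothety] D(2) show ?thesis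
    using closed_compactin by blast
qed

text \<open>\<open>F\<close> separates the points of \<open>L\<close>, so induction on
  \<open>F\<close> splits off one dimension at a time: a vector \<open>d\<close> of \<open>L\<close>
  with \<open>\<phi> d = 1\<close>, then the part of \<open>L\<close> in the kernel of
  \<open>\<phi>\<close>. Weak continuity of \<open>P\<close> is encoded by the clause with
  \<open>\<theta>\<close>.\<close>

lemma finite_rank_projection:
  fixes L :: "'a::hausdorff_lcs set"
  assumes "finite F" "subspace L" "\<And>d. d \<in> L \<Longrightarrow> \<forall>\<phi>\<in>F. dual_apply \<phi> d = 0 \<Longrightarrow> d = 0"
  shows "\<exists>P B. linear P \<and> (\<forall>\<psi>. \<exists>\<theta>. \<forall>x. dual_apply \<psi> (P x) = dual_apply \<theta> x) \<and>
    (\<forall>x\<in>L. P x = x) \<and> (\<forall>x. P x \<in> span B) \<and> finite B \<and> B \<subseteq> L"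
  using assms
proof (induction F arbitrary: L rule: finite_induct)
  case empty
  have "linear (\<lambda>x::'a. 0::'a)" by (simp add: linear_iff)
  moreover have "\<exists>\<theta>. \<forall>x. dual_apply \<psi> 0 = dual_apply \<theta> x" for \<psi> :: "'a continuous_dual"
    by (rule exI[of _ 0]) (simp add: dual_apply_simps)
  ultimately show ?case using empty by (intro exI[of _ "\<lambda>x. 0"] exI[of _ "{}"]) auto
next
  case (insert \<phi> F)
  show ?case
  proof (cases "\<exists>d\<in>L. dual_apply \<phi> d \<noteq> 0")
    case False
    with insert.prems show ?thesis by (intro insert.IH) auto
  next
    case True
    then obtain d' where d': "d' \<in> L" "dual_apply \<phi> d' \<noteq> 0" by blast
    define d where "d = (1 / dual_apply \<phi> d') *\<^sub>R d'"
    have d: "d \<in> L" "dual_apply \<phi> d = 1"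
      using d' subspace_scale[OF insert.prems(1)] by (auto simp: d_def dual_apply_simps)
    define M where "M = {x \<in> L. dual_apply \<phi> x = 0}"
    have "subspace M" using insert.prems(1) by (auto simp: M_def subspace_def dual_apply_simps)
    moreover have "x = 0" if "x \<in> M" "\<forall>\<phi>\<in>F. dual_apply \<phi> x = 0" for x
      using insert.prems(2)[of x] that by (auto simp: M_def)
    ultimately obtain P B where P: "linear P" "\<And>\<psi>. \<exists>\<theta>. \<forall>x. dual_apply \<psi> (P x) = dual_apply \<theta> x"
      "\<And>x. x \<in> M \<Longrightarrow> P x = x" "\<And>x. P x \<in> span B" "finite B" "B \<subseteq> M"
      using insert.IH[of M] by metis
    define Q where "Q x = dual_apply \<phi> x *\<^sub>R d + P (x - dual_apply \<phi> x *\<^sub>R d)" for x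
    \<comment> \<open>The new projection differs from \<open>P\<close> by a rank-one map, from which
      linearity and the functional \<open>\<theta>\<close> can be read off.\<close>
    have Q: "Q x = P x + dual_apply \<phi> x *\<^sub>R (d - P d)" for x
      by (simp add: Q_def linear_diff[OF P(1)] linear_scale[OF P(1)] algebra_simps)
    have "linear Q"
      by (rule linearI) (simp_all add: Q linear_add[OF P(1)] linear_scale[OF P(1)] dual_apply_simps algebra_simps)
    moreover have "\<exists>\<theta>. \<forall>x. dual_apply \<psi> (Q x) = dual_apply \<theta> x" for \<psi>
    proof -
      obtain \<theta> where "\<And>x. dual_apply \<psi> (P x) = dual_apply \<theta> x" using P(2) by blast
      then have "dual_apply \<psi> (Q x) = dual_apply (\<theta> + dual_apply \<psi> (d - P d) *\<^sub>R \<phi>) x" for x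
        by (simp only: Q dual_apply_simps) (simp add: algebra_simps)
      then show ?thesis by blast
    qed
    moreover have "Q x = x" if "x \<in> L" for x
    proof -
      have "x - dual_apply \<phi> x *\<^sub>R d \<in> M"
        using that d subspace_diff[OF insert.prems(1)] subspace_scale[OF insert.prems(1)]
        by (simp add: M_def dual_apply_simps)
      from P(3)[OF this] show ?thesis by (simp add: Q_def)
    qed
    moreover have "Q x \<in> span (insert d B)" for x
      unfolding Q_def using P(4) span_mono[of B "insert d B"]
      by (intro span_add span_scale) (auto intro: span_base)
    ultimately show ?thesis using P(5,6) d(1)
      by (intro exI[of _ Q] exI[of _ "insert d B"]) (auto simp: M_def)
  qed
qed

text \<open>A nonzero direction of \<open>L\<close> killed by all of \<open>F\<close> would put a
  whole line into a compact set, although some functional is unbounded on that line.\<close>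

lemma weakly_locally_compact_finite_separation:
  fixes C :: "'a::hausdorff_lcs set"
  assumes lc: "locally_compact_space (subtopology weak_topology C)" and a: "a \<in> C"
    and L: "subspace L" "\<And>d. d \<in> L \<Longrightarrow> a + d \<in> C"
  obtains F where "finite F" "\<And>d. d \<in> L \<Longrightarrow> \<forall>\<phi>\<in>F. dual_apply \<phi> d = 0 \<Longrightarrow> d = 0"
proof -
  obtain F e K where F: "finite F" "0 < e" "compactin weak_topology K"
    "{y \<in> C. (\<Sum>\<phi>\<in>F. \<bar>dual_apply \<phi> (y - a)\<bar>) \<le> e} \<subseteq> K"
    by (rule weakly_locally_compact_nhd[OF lc a])
  show thesis
  proof (rule that[OF F(1)], rule dual_separates_zero, rule ccontr)
    fix d \<psi> assume d: "d \<in> L" "\<forall>\<phi>\<in>F. dual_apply \<phi> d = 0" and \<psi>: "dual_apply \<psi> d \<noteq> 0"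
    have line: "a + t *\<^sub>R d \<in> K" for t
    proof -
      have "a + t *\<^sub>R d \<in> C" using L(2) subspace_scale[OF L(1) d(1)] by blast
      moreover have "(\<Sum>\<phi>\<in>F. \<bar>dual_apply \<phi> (a + t *\<^sub>R d - a)\<bar>) = 0" using d(2)
        by (simp add: dual_apply_simps)
      ultimately show ?thesis using F(2,4) by auto
    qed
    have "compact (dual_apply \<psi> ` K)"
      using image_compactin[OF F(3) continuous_map_weak_dual_apply] by simp
    then have "bounded (dual_apply \<psi> ` K)" by (rule compact_imp_bounded)
    then obtain b where b: "\<And>x. x \<in> K \<Longrightarrow> \<bar>dual_apply \<psi> x\<bar> \<le> b" by (auto simp: bounded_iff)
    define t where "t = (b + 1 - dual_apply \<psi> a) / dual_apply \<psi> d"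
    have "dual_apply \<psi> (a + t *\<^sub>R d) = b + 1" using \<psi> by (simp add: dual_apply_simps t_def)
    with b[OF line[of t]] show False by linarith
  qed
qed

text \<open>\<open>rec\<close> carries the subspace hypothesis: recession directions of sublevel
  sets are lineality directions and form \<open>L\<close>. Once \<open>L\<close> is split off, no
  ray remains and the slices become compact.\<close>

lemma minimizers_decomposition:
  fixes h :: "'a::hausdorff_lcs \<Rightarrow> ereal"
  assumes level: "\<And>x r. h x \<le> ereal r \<longleftrightarrow> (\<forall>(\<phi>, s)\<in>Q. dual_apply \<phi> x - s \<le> r)"
    and m: "\<And>x. ereal m \<le> h x" "\<And>r. m < r \<Longrightarrow> \<exists>x. h x \<le> ereal r"
    and lc: "locally_compact_space (subtopology weak_topology {x. h x \<le> ereal (m + 1)})"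
    and rec: "\<And>d. \<forall>(\<phi>, s)\<in>Q. dual_apply \<phi> d \<le> 0 \<Longrightarrow> \<forall>(\<phi>, s)\<in>Q. dual_apply \<phi> d = 0"
  shows "\<exists>K L. K \<noteq> {} \<and> convex K \<and> compactin weak_topology K \<and>
           subspace L \<and> (\<exists>B. finite B \<and> L = span B) \<and>
           minimizers h = {k + l | k l. k \<in> K \<and> l \<in> L}"
proof -
  define C where "C r = {x. h x \<le> ereal r}" for r
  have C_eq: "C r = (\<Inter>(\<phi>, s)\<in>Q. {x. dual_apply \<phi> x \<in> {..r + s}})" for r
    by (auto simp: C_def level split: prod.splits)
  have C_closed: "closedin weak_topology (C r)" for r
  proof (cases "Q = {}")
    case False
    then show ?thesis unfolding C_eq
      by (intro closedin_Inter) (auto intro!: closedin_weak_preimage continuous_map_weak_dual_apply closed_atMost simp del: atMost_iff)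
  qed (use closedin_topspace[of weak_topology] in \<open>simp add: C_eq\<close>)
  have C_convex: "convex (C r)" for r
  proof -
    have "convex {x. dual_apply \<phi> x \<in> {..c}}" for \<phi> c
      using convex_linear_vimage[OF linear_dual_apply, of "{..c}" \<phi>] by (simp add: vimage_def)
    then show ?thesis unfolding C_eq by (intro convex_INT) auto
  qed
  define L where "L = {d. \<forall>(\<phi>, s)\<in>Q. dual_apply \<phi> d = 0}"
  have L: "subspace L" by (auto simp: L_def subspace_def dual_apply_simps split_beta)
  have CL: "x + d \<in> C r" if "x \<in> C r" "d \<in> L" for x d r
    using that by (fastforce simp: C_def level L_def dual_apply_simps)
  have ray: "d \<in> L" if C: "\<And>t. 0 \<le> t \<Longrightarrow> a + t *\<^sub>R d \<in> C r" for a d r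
  proof -
    have "dual_apply \<phi> d \<le> 0" if q: "(\<phi>, s) \<in> Q" for \<phi> s
    proof (rule ccontr)
      assume pos: "\<not> dual_apply \<phi> d \<le> 0"
      \<comment> \<open>With a positive slope along \<open>d\<close>, the ray has left level
        \<open>r\<close> at this parameter.\<close>
      define t where "t = (\<bar>r + s - dual_apply \<phi> a\<bar> + 1) / dual_apply \<phi> d"
      have "0 \<le> t" using pos by (simp add: t_def)
      from C[OF this] q have "dual_apply \<phi> a + t * dual_apply \<phi> d - s \<le> r"
        by (fastforce simp: C_def level dual_apply_simps)
      moreover have "t * dual_apply \<phi> d = \<bar>r + s - dual_apply \<phi> a\<bar> + 1" using pos
        by (simp add: t_def)
      ultimately show False by linarith
    qed
    then show ?thesis unfolding L_def using rec by blast
  qed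
  obtain a0 where a0: "a0 \<in> C (m + 1)" using m(2)[of "m + 1"] by (auto simp: C_def)
  have lc': "locally_compact_space (subtopology weak_topology (C (m + 1)))" using lc
    by (simp add: C_def)
  obtain F where F: "finite F" "\<And>d. d \<in> L \<Longrightarrow> \<forall>\<phi>\<in>F. dual_apply \<phi> d = 0 \<Longrightarrow> d = 0"
    using weakly_locally_compact_finite_separation[OF lc' a0 L CL[OF a0]] by metis
  obtain P B where P: "linear P" "\<And>\<psi>. \<exists>\<theta>. \<forall>x. dual_apply \<psi> (P x) = dual_apply \<theta> x"
    "\<And>x. x \<in> L \<Longrightarrow> P x = x" "\<And>x. P x \<in> span B" "finite B" "B \<subseteq> L"
    using finite_rank_projection[OF F(1) L F(2)] by metis
  have spanB: "span B \<subseteq> L" using span_minimal[OF P(6) L] .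
  have LB: "L = span B" using spanB P(3,4) by (metis subsetI subset_antisym)
  have PL: "P x \<in> L" for x using P(4) spanB by blast
  define D where "D r = C r \<inter> {x. P x = 0}" for r
  have Pcont: "continuous_map weak_topology weak_topology P"
  proof (rule continuous_map_into_weak_topology)
    fix \<psi> obtain \<theta> where "\<And>x. dual_apply \<psi> (P x) = dual_apply \<theta> x" using P(2) by blast
    then show "continuous_map weak_topology euclideanreal (\<lambda>x. dual_apply \<psi> (P x))"
      using continuous_map_weak_dual_apply[of \<theta>] by simp
  qed
  have kerP: "{x. P x = 0} = (\<Inter>\<psi>. {x. dual_apply \<psi> (P x) \<in> {0}})"
    using dual_separates_zero by (auto simp: dual_apply_simps)
  have "closedin weak_topology {x. dual_apply \<psi> (P x) \<in> {0}}" for \<psi>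
    using continuous_map_compose[OF Pcont continuous_map_weak_dual_apply]
    by (intro closedin_weak_preimage) (simp_all add: o_def)
  then have "closedin weak_topology {x. P x = 0}" unfolding kerP by (intro closedin_Inter) blast+
  then have D_closed: "closedin weak_topology (D r)" for r unfolding D_def
    by (intro closedin_Int C_closed)
  have D_convex: "convex (D r)" for r
  proof -
    have "subspace {x. P x = 0}" using linear_subspace_kernel[OF P(1)] .
    then show ?thesis unfolding D_def by (intro convex_Int C_convex subspace_imp_convex)
  qed
  \<comment> \<open>Removing the component in \<open>L\<close> preserves the level and lands in the
    kernel of \<open>P\<close>, so every nonempty sublevel set has a nonempty slice.\<close>
  have CD: "x - P x \<in> D r" if "x \<in> C r" for x r
    using CL[OF that subspace_neg[OF L PL[of x]]] P(3)[OF PL]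
    by (simp add: D_def linear_diff[OF P(1)])
  have D_mono: "D r \<subseteq> D s" if "r \<le> s" for r s
    using that by (auto simp: D_def C_def) (meson ereal_less_eq(3) order_trans)
  define a where "a = a0 - P a0"
  have a: "a \<in> D (m + 1)" unfolding a_def by (rule CD[OF a0])
  then have aC: "a \<in> C (m + 1)" by (simp add: D_def)
  obtain F' e K where F': "finite F'" "0 < e" "compactin weak_topology K"
    "{y \<in> C (m + 1). (\<Sum>\<phi>\<in>F'. \<bar>dual_apply \<phi> (y - a)\<bar>) \<le> e} \<subseteq> K"
    by (rule weakly_locally_compact_nhd[OF lc' aC])
  have D_compact: "compactin weak_topology (D (m + 1))"
  proof (rule compactin_weak_if_no_ray[OF D_convex D_closed a F'(2,3)])
    show "{y \<in> D (m + 1). (\<Sum>\<phi>\<in>F'. \<bar>dual_apply \<phi> (y - a)\<bar>) \<le> e} \<subseteq> K" using F'(4)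
      by (auto simp: D_def)
    fix d assume d: "\<And>t. 0 \<le> t \<Longrightarrow> a + t *\<^sub>R d \<in> D (m + 1)"
    then have "d \<in> L" by (intro ray[of a d "m + 1"]) (auto simp: D_def)
    moreover have "P d = 0" using d[of 1] a by (simp add: D_def linear_add[OF P(1)])
    ultimately show "d = 0" using P(3) by simp
  qed
  \<comment> \<open>These levels start at \<open>m + 1\<close>, inside the compact slice, and
    decrease to \<open>m\<close>; a point common to all slices is a minimizer.\<close>
  define E where "E n = D (m + 1 / (real n + 1))" for n
  have "D (m + 1) \<inter> (\<Inter>n. E n) \<noteq> {}"
  proof (rule compactin_decseq_Inter_nonempty[OF D_compact])
    show "closedin weak_topology (E n)" for n by (simp add: E_def D_closed)
    show "D (m + 1) \<inter> E n \<noteq> {}" for n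
    proof -
      obtain x where "h x \<le> ereal (m + 1 / (real n + 1))" using m(2)[of "m + 1 / (real n + 1)"]
        by auto
      then have "x - P x \<in> E n" unfolding E_def by (intro CD) (simp add: C_def)
      moreover have "E n \<subseteq> D (m + 1)" unfolding E_def by (rule D_mono) simp
      ultimately show ?thesis by blast
    qed
    show "decseq E" unfolding decseq_def E_def by (intro allI impI D_mono) (simp add: frac_le)
  qed
  then obtain x where x: "\<And>n. x \<in> E n" by blast
  have "h x \<le> ereal m"
    unfolding level
  proof clarify
    fix \<phi> s assume q: "(\<phi>, s) \<in> Q"
    have "dual_apply \<phi> x - s \<le> m + 1 / (real n + 1)" for n
      using x[of n] q by (fastforce simp: E_def D_def C_def level)
    moreover have "(\<lambda>n. m + 1 / (real n + 1)) \<longlonglongrightarrow> m"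
      using tendsto_add[OF tendsto_const LIMSEQ_inverse_real_of_nat, of m]
      by (simp add: inverse_eq_divide add.commute)
    ultimately show "dual_apply \<phi> x - s \<le> m" by (intro LIMSEQ_le_const) blast+
  qed
  then have xD: "x \<in> D m" using x[of 0] unfolding D_def C_def E_def by blast
  have "minimizers h = C m"
    using \<open>h x \<le> ereal m\<close> m(1) by (auto simp: minimizers_def C_def intro: order_trans)
  also have "C m = {k + l | k l. k \<in> D m \<and> l \<in> L}"
  proof (intro subset_antisym subsetI)
    fix y assume "y \<in> C m"
    then have "y - P y \<in> D m" by (rule CD)
    then show "y \<in> {k + l | k l. k \<in> D m \<and> l \<in> L}" using PL[of y] by force
  next
    fix y assume "y \<in> {k + l | k l. k \<in> D m \<and> l \<in> L}"
    then show "y \<in> C m" using CL by (auto simp: D_def)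
  qed
  finally have "minimizers h = {k + l | k l. k \<in> D m \<and> l \<in> L}" .
  moreover have "compactin weak_topology (D m)"
    by (rule closed_compactin[OF D_compact D_mono D_closed]) simp
  ultimately show ?thesis using xD D_convex L LB P(5) by blast
qed

subsection \<open>Minimizers and duality\<close>

text \<open>The functionals that are nonpositive at \<open>d\<close> form a convex cone, weak-star
  closed because evaluation at \<open>d\<close> is continuous.\<close>

lemma nonpos_on_closure_cone_gen:
  assumes "\<And>\<phi>. \<phi> \<in> E \<Longrightarrow> dual_apply \<phi> d \<le> 0" "\<phi> \<in> closure (cone_gen (convex hull E))"
  shows "dual_apply \<phi> d \<le> 0"
proof -
  let ?H = "{\<phi>. dual_apply \<phi> d \<le> 0}"
  have "convex ?H"
    by (auto simp: convex_def dual_apply_simps intro!: add_nonpos_nonpos mult_nonneg_nonpos)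
  then have "convex hull E \<subseteq> ?H" using assms(1) by (intro hull_minimal) auto
  moreover have "cone ?H" by (auto simp: cone_def dual_apply_simps intro: mult_nonneg_nonpos)
  ultimately have "cone_gen (convex hull E) \<subseteq> ?H"
    unfolding cone_gen_def by (intro hull_minimal) (auto simp: dual_apply_simps)
  moreover have "closed ?H"
    using continuous_closed_vimage[OF closed_atMost[of 0]] continuous_on_dual_eval[of d]
    by (simp add: closed_Collect_le continuous_on_const)
  ultimately show ?thesis using assms(2) closure_minimal by blast
qed

theorem proposition6p1:
  fixes f :: "'i \<Rightarrow> 'a::hausdorff_lcs \<Rightarrow> ereal" and I :: "'i set"
  assumes "infinite I"
    and "\<forall>i\<in>I. f i \<in> Gamma_fun"
    and "\<not> (\<exists>x. \<forall>i\<in>I. f i x \<le> 0)"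
    and "proper_fun (sup_fun I f)"
    and "weakly_inf_locally_compact (sup_fun I f)"
    and "subspace (closure (cone_gen (convex hull (\<Union>i\<in>I. edom (fenchel_conj (f i))))))"
  shows "(\<exists>K L. K \<noteq> {} \<and> convex K \<and> compactin weak_topology K \<and>
           subspace L \<and> (\<exists>B. finite B \<and> L = span B) \<and>
           minimizers (sup_fun I f) = {k + l | k l. k \<in> K \<and> l \<in> L}) \<and>
         (is_max_of (INF x. SUP i\<in>I. f i x)
           ((\<lambda>l. INF x. weighted_sum l f x) ` unit_simplex I)
         \<longleftrightarrow>
         closed_regarding (\<Union>l\<in>unit_simplex I. epi (fenchel_conj (weighted_sum l f)))
           ({0} \<times> UNIV))"
proof -
  let ?h = "sup_fun I f"
  define A where "A = (\<Union>l\<in>unit_simplex I. epi (fenchel_conj (weighted_sum l f)))"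
  note f = assms(2)
  have I: "I \<noteq> {}" using assms(1) by auto
  \<comment> \<open>Inconsistency bounds the supremum below by 0; together with properness this
    makes its infimum a real number \<open>m\<close>.\<close>
  have pos: "0 \<le> ?h x" for x
  proof -
    obtain i where "i \<in> I" "\<not> f i x \<le> 0" using assms(3) by blast
    then show ?thesis unfolding sup_fun_def by (meson SUP_upper2 linear)
  qed
  obtain x0 where "?h x0 < \<infinity>" using assms(4) by (auto simp: proper_fun_def edom_def)
  then obtain \<rho> where \<rho>: "?h x0 \<le> ereal \<rho>" using pos[of x0] by (cases "?h x0") auto
  have "0 \<le> (INF x. ?h x)" "(INF x. ?h x) \<le> ereal \<rho>"
    using pos \<rho> by (auto intro: INF_greatest INF_lower2)
  then obtain m where m: "(INF x. ?h x) = ereal m" by (cases "INF x. ?h x") auto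
  have m_le: "ereal m \<le> ?h x" for x using m by (metis INF_lower UNIV_I)
  have m_approx: "\<exists>x. ?h x \<le> ereal r" if "m < r" for r
  proof -
    have "(INF x. ?h x) < ereal r" using m that by simp
    then show ?thesis by (auto simp: INF_less_iff intro: less_imp_le)
  qed
  let ?Q = "\<Union>i\<in>I. epi (fenchel_conj (f i))"
  let ?E = "\<Union>i\<in>I. edom (fenchel_conj (f i))"
  let ?Y = "closure (cone_gen (convex hull ?E))"
  have QE: "\<phi> \<in> ?E \<longleftrightarrow> (\<exists>s. (\<phi>, s) \<in> ?Q)" for \<phi> by (auto simp: edom_fenchel_conj_iff)
  have EY: "?E \<subseteq> ?Y"
    unfolding cone_gen_def by (meson closure_subset hull_subset order_trans subset_insertI)
  \<comment> \<open>The closed cone is a subspace, so it contains \<open>- \<phi>\<close> along with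
    each normal \<open>\<phi>\<close>, and the inequality becomes an equality.\<close>
  have rec: "\<forall>(\<phi>, s)\<in>?Q. dual_apply \<phi> d = 0" if "\<forall>(\<phi>, s)\<in>?Q. dual_apply \<phi> d \<le> 0" for d
  proof -
    have E: "dual_apply \<phi> d \<le> 0" if "\<phi> \<in> ?E" for \<phi>
      using that \<open>\<forall>(\<phi>, s)\<in>?Q. dual_apply \<phi> d \<le> 0\<close> unfolding QE by fastforce
    have "dual_apply \<phi> d = 0" if "\<phi> \<in> ?E" for \<phi>
    proof -
      have "- \<phi> \<in> ?Y" using subspace_neg[OF assms(6)] EY that by blast
      from nonpos_on_closure_cone_gen[OF E this] E[OF that] show ?thesis
        by (simp add: dual_apply_simps)
    qed
    then show ?thesis unfolding QE by blast
  qed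
  have part1: "\<exists>K L. K \<noteq> {} \<and> convex K \<and> compactin weak_topology K \<and>
           subspace L \<and> (\<exists>B. finite B \<and> L = span B) \<and>
           minimizers ?h = {k + l | k l. k \<in> K \<and> l \<in> L}"
    by (rule minimizers_decomposition[OF sup_fun_le_iff[OF f] m_le m_approx _ rec])
      (use assms(5) in \<open>simp_all add: weakly_inf_locally_compact_def\<close>)
  \<comment> \<open>The conjugate at 0 is minus the infimum, so the points of \<open>A\<close> over
    0 record the dual values.\<close>
  have zero_iff: "(0, r) \<in> A \<longleftrightarrow> (\<exists>l\<in>unit_simplex I. ereal (- r) \<le> (INF x. weighted_sum l f x))" for r
    by (simp add: A_def epi_fenchel_conj_iff dual_apply_simps le_INF_iff)
  have weak: "(INF x. weighted_sum l f x) \<le> ereal m" if l: "l \<in> unit_simplex I" for l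
  proof -
    have "weighted_sum l f x \<le> ?h x" for x
      using m_le[of x] by (intro weighted_sum_le[OF l]) (auto simp: sup_fun_def intro: SUP_upper)
    then show ?thesis unfolding m[symmetric] by (intro INF_mono) auto
  qed
  have max_iff: "is_max_of (INF x. SUP i\<in>I. f i x) ((\<lambda>l. INF x. weighted_sum l f x) ` unit_simplex I)
      \<longleftrightarrow> (0, - m) \<in> A"
  proof -
    have "(INF x. SUP i\<in>I. f i x) = ereal m" using m by (simp add: sup_fun_def)
    then show ?thesis using weak unfolding zero_iff is_max_of_def
      by (auto intro: antisym simp: image_iff)
  qed
  have A_mono: "(\<phi>, s) \<in> A" if "(\<phi>, r) \<in> A" "r \<le> s" for \<phi> r s
    using that unfolding A_def by (blast intro: epi_mono)
  have closure_m: "(0, - m) \<in> closure A"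
  proof (rule minus_inf_in_closure[OF f I \<rho> m_le _ A_mono])
    show "convex A" unfolding A_def
      by (rule convex_Union_epi_weighted_sum) (use f in \<open>auto simp: Gamma_fun_def proper_fun_def\<close>)
    fix i assume "i \<in> I"
    then obtain l where "l \<in> unit_simplex I" "weighted_sum l f = f i"
      by (rule point_mass_in_unit_simplex)
    then show "epi (fenchel_conj (f i)) \<subseteq> A" unfolding A_def by force
  qed
  have upper: "- m \<le> r" if "(0, r) \<in> closure A" for r
  proof -
    \<comment> \<open>An intersection of closed half-spaces containing \<open>A\<close> by weak
      duality; quantifying over real \<open>y\<close> above \<open>?h x\<close> leaves out the
      points of infinite value.\<close>
    let ?H = "{a :: 'a continuous_dual \<times> real. \<forall>x y. ?h x \<le> ereal y \<longrightarrow> dual_apply (fst a) x - snd a \<le> y}"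
    have "A \<subseteq> ?H" unfolding A_def
    proof clarify
      fix l \<phi> r x y assume l: "l \<in> unit_simplex I"
        and \<phi>: "(\<phi>, r) \<in> epi (fenchel_conj (weighted_sum l f))"
        and y: "?h x \<le> ereal y"
      have "ereal (dual_apply \<phi> x - r) \<le> weighted_sum l f x" using \<phi>
        by (simp add: epi_fenchel_conj_iff)
      also have "\<dots> \<le> ereal y"
        by (rule weighted_sum_le[OF l]) (use y in \<open>auto simp: sup_fun_def SUP_le_iff\<close>)
      finally show "dual_apply (fst (\<phi>, r)) x - snd (\<phi>, r) \<le> y" by simp
    qed
    moreover have "closed ?H"
    proof -
      have "continuous_on UNIV (\<lambda>a :: 'a continuous_dual \<times> real. dual_apply (fst a) x - snd a)" for x
        by (intro continuous_intros continuous_on_compose2[OF continuous_on_dual_eval[of x]]) auto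
      then show ?thesis
        by (intro closed_Collect_all closed_Collect_imp closed_Collect_le continuous_on_const) auto
    qed
    ultimately have "(0, r) \<in> ?H" using that closure_minimal by blast
    then have ge: "- r \<le> y" if "?h x \<le> ereal y" for x y using that by (auto simp: dual_apply_simps)
    have "- r \<le> m" by (rule dense_ge) (use m_approx ge in blast)
    then show ?thesis by simp
  qed
  \<comment> \<open>Over 0 the closure of \<open>A\<close> is exactly the half-line from
    \<open>- m\<close> upwards. Since \<open>A\<close> is upward closed, the two slices agree
    precisely when the endpoint belongs to \<open>A\<close>.\<close>
  have "(0, - m) \<in> A \<longleftrightarrow> closed_regarding A ({0} \<times> UNIV)"
  proof
    assume in_A: "(0, - m) \<in> A"
    have "(0, r) \<in> A" if "(0, r) \<in> closure A" for r
      using upper[OF that] A_mono[OF in_A] by simp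
    then show "closed_regarding A ({0} \<times> UNIV)"
      unfolding closed_regarding_def using closure_subset[of A] by auto
  next
    assume "closed_regarding A ({0} \<times> UNIV)"
    then show "(0, - m) \<in> A" using closure_m unfolding closed_regarding_def by blast
  qed
  with part1 max_iff show ?thesis unfolding A_def by blast
qed

end
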